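(* Let $G$ be an abelian group and let $S$ be a zero-sum free subset of $G$ with $|S|=6$. Then $|\Sigma(S)|=19$ if and only if there exist $x_1,x_2,x_3\in G$ such that $S$ is one of the following: (i) $S=\{x_1,\ x_2,\ x_3,\ x_1+x_3,\ x_2+x_3,\ x_1+x_2+x_3\}$, where $\operatorname{ord}(x_1)=2$ and $2x_2\in\langle x_1\rangle$; (ii) $S=\{x_1,\ x_2,\ 2x_2,\ 3x_2,\ x_1+x_2,\ x_1+2x_2\}$, where $\operatorname{ord}(x_1)=2$; (iii) $S=\{-2x_1,\ x_1,\ 3x_1,\ 4x_1,\ 5x_1,\ 6x_1\}$, where $\operatorname{ord}(x_1)=20$; (iv) $S=\{-3x_1,\ x_1,\ 4x_1,\ 5x_1,\ 9x_1,\ 12x_1\}$, where $\operatorname{ord}(x_1)=20$; (v) $S=\{x_1,\ x_2,\ x_1+x_2,\ x_1+2x_2,\ 2x_1+x_2,\ 4x_1+4x_2\}$, where $2x_1=2x_2$ and $\operatorname{ord}(x_1)=\operatorname{ord}(x_2)=10$. (In each case the six listed elements are required to be distinct, since $S$ is a set of size $6$.)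
   Context: $G$ is written additively. For a finite subset $S\subseteq G$, $\Sigma(S)$ denotes the set of all elements $\sum_{g\in T} g$ where $T$ ranges over the nonempty subsets of $S$. $S$ is called zero-sum free if $0\notin\Sigma(S)$. $\operatorname{ord}(g)$ denotes the order of $g\in G$. *)

theory Defs
  imports Main "HOL-Computational_Algebra.Group_Closure"
begin

primrec nat_mult :: "nat \<Rightarrow> 'a::ab_group_add \<Rightarrow> 'a" (infixr \<open>\<cdot>\<close> 75) where
  "0 \<cdot> x = 0"
| "Suc n \<cdot> x = x + n \<cdot> x"

text \<open>Elements of infinite order get the value 0, as for \<open>ord\<close> in HOL-Algebra.\<close>

definition add_ord :: "'a::ab_group_add \<Rightarrow> nat" where
  "add_ord x = (if \<exists>n>0. n \<cdot> x = 0 then LEAST n. n > 0 \<and> n \<cdot> x = 0 else 0)"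

text \<open>Meant for finite \<open>S\<close> only: a sum over an infinite \<open>T\<close> is 0 by convention.\<close>

definition subset_sums :: "'a::ab_group_add set \<Rightarrow> 'a set" where
  "subset_sums S = {\<Sum>g\<in>T. g | T. T \<subseteq> S \<and> T \<noteq> {}}"

definition zero_sum_free :: "'a::ab_group_add set \<Rightarrow> bool" where
  "zero_sum_free S \<longleftrightarrow> 0 \<notin> subset_sums S"

end

theory Submission
  imports Defs
begin

text \<open>
  The integer relations between the six elements of \<open>S\<close> form a lattice. If there are only 19 nonempty
  subset sums, then among any 21 of the 64 subset sums (the empty one included) two coincide, which
  adds a relation. Most coincidences are impossible, because together with the relations already present
  they make a nonempty subset sum zero or two elements equal. Each of the others yields a lattice which,
  up to reordering the elements, contains a lattice already shown to force the conclusion. Starting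
  from the relation lattices of the five families, 81 such steps reach the zero lattice, which is
  contained in every relation lattice. The steps were found by a computer search and are verified by a
  checker that is proved sound.
\<close>

section \<open>Integer linear combinations\<close>

text \<open>The group is arbitrary, so there is no finite list of groups to inspect. All reasoning
  about \<open>S\<close> is therefore reduced to integer vectors of length 6 of two kinds: those
  known to vanish (the relations) and those known not to vanish, namely the 63 nonzero 0-1 vectors,
  by zero-sum freeness, and the 15 differences of unit vectors, by distinctness, all up to sign. A
  coincidence counts as impossible only if its vector agrees, modulo the relations, with one of
  these or with a coincidence already disposed of; no finer arithmetic of the group is used.

  The obstacle is that the order conditions in the five families are not relations: a relation can
  say \<open>20 \<cdot> x = 0\<close>, but not that 20 is least. They come back at no cost, because
  modulo the relations of a family every smaller positive multiple is again one of the vectors known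
  not to vanish.

  The converse uses the same test: modulo the relations of a family the 64 subset sums collapse to
  20 normal forms, and the test tells all of these apart. One of them is the empty sum, which leaves
  19.\<close>

definition int_mult :: "int \<Rightarrow> 'a::ab_group_add \<Rightarrow> 'a" (infixr \<open>\<odot>\<close> 75) where
  "k \<odot> x = (if k \<ge> 0 then nat k \<cdot> x else - (nat (- k) \<cdot> x))"

lemma int_mult_0 [simp]: "0 \<odot> x = 0"
  by (simp add: int_mult_def)

lemma int_mult_add_1: "(k + 1) \<odot> x = k \<odot> x + x"
proof (cases "k \<ge> 0")
  case True
  then show ?thesis
    by (simp add: int_mult_def nat_add_distrib add.commute)
next
  case False
  then obtain n where "k = - int (Suc n)"
    by (metis int_cases not_le of_nat_0_le_iff)
  then show ?thesis
    by (simp add: int_mult_def nat_add_distrib)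
qed

lemma int_mult_1 [simp]: "1 \<odot> x = x"
  using int_mult_add_1 [of 0 x] by simp

lemma int_mult_diff_1: "(k - 1) \<odot> x = k \<odot> x - x"
  using int_mult_add_1 [of "k - 1" x] by simp

lemma int_mult_add_left: "(j + k) \<odot> x = j \<odot> x + k \<odot> x"
proof (induction k rule: int_induct [of _ 0])
  case (step1 k)
  then show ?case
    by (simp add: int_mult_add_1 add.assoc [symmetric])
next
  case (step2 k)
  then show ?case
    by (simp add: int_mult_diff_1 add_diff_eq [symmetric] add.assoc)
       (simp add: add_diff_eq int_mult_diff_1)
qed simp

lemma int_mult_minus_left: "(- k) \<odot> x = - (k \<odot> x)"
  using int_mult_add_left [of "- k" k x] by (simp add: eq_neg_iff_add_eq_0)

lemma int_mult_diff_left: "(j - k) \<odot> x = j \<odot> x - k \<odot> x"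
  using int_mult_add_left [of j "- k" x] by (simp add: int_mult_minus_left)

lemma int_mult_0_right [simp]: "k \<odot> 0 = 0"
  by (induction k rule: int_induct [of _ 0]) (simp_all add: int_mult_add_1 int_mult_diff_1)

lemma int_mult_add_right: "k \<odot> (x + y) = k \<odot> x + k \<odot> y"
  by (induction k rule: int_induct [of _ 0])
     (simp_all add: int_mult_add_1 int_mult_diff_1 algebra_simps)

lemma int_mult_mult: "(j * k) \<odot> x = j \<odot> (k \<odot> x)"
  by (induction j rule: int_induct [of _ 0])
     (simp_all add: int_mult_add_1 int_mult_diff_1 int_mult_add_left int_mult_diff_left algebra_simps)

lemma int_mult_of_nat: "int n \<odot> x = n \<cdot> x"
  by (simp add: int_mult_def)

section \<open>Coefficient vectors and reduction modulo relations\<close>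

fun lincomb :: "int list \<Rightarrow> 'a::ab_group_add list \<Rightarrow> 'a" where
  "lincomb (a # v) (x # xs) = a \<odot> x + lincomb v xs"
| "lincomb _ _ = 0"

text \<open>Missing coordinates count as 0, here as in \<open>lincomb\<close> and
  \<open>vdiff\<close>. So \<open>[]\<close> serves as the zero vector, \<open>vdiff [] d\<close> is
  the negative of \<open>d\<close>, and the evaluation lemmas for both operations need no hypotheses
  on lengths.\<close>

fun submul :: "int \<Rightarrow> int list \<Rightarrow> int list \<Rightarrow> int list" where
  "submul c [] v = v"
| "submul c (a # r) [] = - (c * a) # submul c r []"
| "submul c (a # r) (b # v) = (b - c * a) # submul c r v"

lemma lincomb_Nil_right [simp]: "lincomb v [] = 0"
  by (cases v) simp_all

lemma lincomb_submul: "lincomb (submul c r v) xs = lincomb v xs - c \<odot> lincomb r xs"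
  by (induction c r v arbitrary: xs rule: submul.induct; case_tac xs)
     (simp_all add: int_mult_add_right int_mult_diff_left int_mult_minus_left int_mult_mult algebra_simps)

fun vdiff :: "int list \<Rightarrow> int list \<Rightarrow> int list" where
  "vdiff u [] = u"
| "vdiff [] (b # v) = - b # vdiff [] v"
| "vdiff (a # u) (b # v) = (a - b) # vdiff u v"

lemma lincomb_vdiff: "lincomb (vdiff u v) xs = lincomb u xs - lincomb v xs"
  by (induction u v arbitrary: xs rule: vdiff.induct; case_tac xs)
     (simp_all add: int_mult_diff_left int_mult_minus_left algebra_simps)

text \<open>The quotient is taken at the pivot of the first vector, its first nonzero coordinate.
  Subtracting that multiple of the row clears the coordinate if the pivot is 1 and otherwise, for a
  positive pivot, leaves the remainder there.\<close>

fun quot :: "int list \<Rightarrow> int list \<Rightarrow> int" where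
  "quot (a # r) (b # v) = (if a = 0 then quot r v else if a = 1 then b else b div a)"
| "quot _ _ = 0"

text \<open>For rows in echelon form, \<open>reduce\<close> yields a normal form modulo the rows.\<close>

primrec reduce :: "int list list \<Rightarrow> int list \<Rightarrow> int list" where
  "reduce [] v = v"
| "reduce (r # rs) v = (let q = quot r v in reduce rs (if q = 0 then v else submul q r v))"

text \<open>Each step subtracts a multiple of a row that vanishes on \<open>xs\<close>, so the value
  is kept whatever \<open>quot\<close> returns. Soundness thus needs no echelon form; that matters
  only for how many coincidences the checker recognises.\<close>

lemma lincomb_reduce:
  "\<forall>r\<in>set rs. lincomb r xs = 0 \<Longrightarrow> lincomb (reduce rs v) xs = lincomb v xs"
  by (induction rs arbitrary: v) (simp_all add: Let_def lincomb_submul)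

primrec lead :: "int list \<Rightarrow> int" where
  "lead [] = 0"
| "lead (a # v) = (if a = 0 then lead v else a)"

primrec is_zero :: "int list \<Rightarrow> bool" where
  "is_zero [] \<longleftrightarrow> True"
| "is_zero (a # v) \<longleftrightarrow> a = 0 \<and> is_zero v"

lemma lincomb_is_zero: "is_zero v \<Longrightarrow> lincomb v xs = 0"
  by (induction v xs rule: lincomb.induct) simp_all

text \<open>
  The coefficient of \<open>d\<close> is guessed: the leading quotient can be wrong when some row has a pivot other
  than 1, and then \<open>- 1\<close> happens to suffice.
\<close>

definition in_span :: "int list list \<Rightarrow> int list \<Rightarrow> int list \<Rightarrow> bool" where
  "in_span rs d v \<longleftrightarrow>
    (let h = reduce rs v
     in is_zero h \<or> is_zero (reduce rs (submul (quot d h) d h)) \<or> is_zero (reduce rs (submul (- 1) d h)))"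

text \<open>Any coefficient of \<open>d\<close> that brings the vector to zero is a valid witness,
  so a bad guess can make the test fail but never make it unsound.\<close>

lemma lincomb_in_span:
  assumes rs: "\<forall>r\<in>set rs. lincomb r xs = 0" and d: "lincomb d xs = 0" and "in_span rs d v"
  shows "lincomb v xs = 0"
proof -
  obtain c where "is_zero (reduce rs v) \<or> is_zero (reduce rs (submul c d (reduce rs v)))"
    using assms(3) unfolding in_span_def Let_def by blast
  then have "lincomb (reduce rs v) xs = 0 \<or> lincomb (reduce rs (submul c d (reduce rs v))) xs = 0"
    using lincomb_is_zero by blast
  then show ?thesis
    by (simp add: lincomb_reduce [OF rs] lincomb_submul d)
qed

fun add_at :: "nat \<Rightarrow> int \<Rightarrow> int list \<Rightarrow> int list" where
  "add_at 0 c [] = [c]"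
| "add_at 0 c (a # v) = (a + c) # v"
| "add_at (Suc i) c [] = 0 # add_at i c []"
| "add_at (Suc i) c (a # v) = a # add_at i c v"

lemma lincomb_add_at:
  "i < length xs \<Longrightarrow> lincomb (add_at i c v) xs = lincomb v xs + c \<odot> (xs ! i)"
  by (induction i c v arbitrary: xs rule: add_at.induct; case_tac xs)
     (simp_all add: int_mult_add_left algebra_simps)

fun scatter :: "nat list \<Rightarrow> int list \<Rightarrow> int list" where
  "scatter (i # q) (a # v) = add_at i a (scatter q v)"
| "scatter _ _ = []"

text \<open>Pulls a relation on the list reordered by \<open>q\<close> back to the original list,
  where the current relations are available to prove it.\<close>

lemma lincomb_scatter:
  "\<forall>i\<in>set q. i < length xs \<Longrightarrow> lincomb (scatter q v) xs = lincomb v (map ((!) xs) q)"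
  by (induction q v rule: scatter.induct) (simp_all add: lincomb_add_at add.commute)

section \<open>0-1 vectors and subset sums\<close>

primrec masks :: "nat \<Rightarrow> int list list" where
  "masks 0 = [[]]"
| "masks (Suc n) = map ((#) 0) (masks n) @ map ((#) 1) (masks n)"

primrec neg_units :: "nat \<Rightarrow> int list list" where
  "neg_units 0 = []"
| "neg_units (Suc n) = (- 1 # replicate n 0) # map ((#) 0) (neg_units n)"

text \<open>These are the vectors e_i - e_j with i < j; that they do not vanish is distinctness of
  the list.\<close>

primrec unit_diffs :: "nat \<Rightarrow> int list list" where
  "unit_diffs 0 = []"
| "unit_diffs (Suc n) = map ((#) 1) (neg_units n) @ map ((#) 0) (unit_diffs n)"

text \<open>The least significant bit comes first, so bit i of a mask belongs to the element
  \<open>xs ! i\<close>.\<close>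

primrec bits :: "nat \<Rightarrow> int \<Rightarrow> int list" where
  "bits 0 k = []"
| "bits (Suc n) k = k mod 2 # bits n (k div 2)"

lemma bits_in_masks: "bits n k \<in> set (masks n)"
proof (induction n arbitrary: k)
  case (Suc n)
  have "k mod 2 = 0 \<or> k mod 2 = 1"
    by presburger
  with Suc show ?case
    by auto
qed simp

lemma lincomb_replicate_0 [simp]: "lincomb (replicate n 0) xs = 0"
  by (induction n arbitrary: xs) (simp, case_tac xs, simp_all)

lemma lincomb_neg_units:
  "v \<in> set (neg_units (length xs)) \<Longrightarrow> - lincomb v xs \<in> set xs"
  by (induction xs arbitrary: v) (auto simp: int_mult_minus_left)

lemma lincomb_unit_diffs:
  "distinct xs \<Longrightarrow> v \<in> set (unit_diffs (length xs)) \<Longrightarrow> lincomb v xs \<noteq> 0"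
proof (induction xs arbitrary: v)
  case (Cons x xs)
  have "x + lincomb u xs \<noteq> 0" if "u \<in> set (neg_units (length xs))" for u
    using lincomb_neg_units [OF that] Cons.prems(1) by (metis add_eq_0_iff2 distinct.simps(2) minus_minus)
  with Cons show ?case
    by auto
qed simp

text \<open>The last clause keeps track of emptiness: nonzero masks must yield nonempty subsets,
  since zero-sum freeness speaks only of those.\<close>

lemma lincomb_masks_eq_sum:
  assumes "distinct xs" and "v \<in> set (masks (length xs))"
  obtains T where "T \<subseteq> set xs" and "lincomb v xs = \<Sum>T" and "T = {} \<longleftrightarrow> is_zero v"
  using assms
proof (induction xs arbitrary: v thesis)
  case (Cons x xs)
  from Cons.prems obtain a u where v: "v = a # u" "a = 0 \<or> a = 1" "u \<in> set (masks (length xs))"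
    by auto
  with Cons obtain T where T: "T \<subseteq> set xs" "lincomb u xs = \<Sum>T" "T = {} \<longleftrightarrow> is_zero u"
    by (metis distinct.simps(2))
  show ?case
  proof (cases "a = 0")
    case True
    with T v show ?thesis
      by (intro Cons.prems(1) [of T]) auto
  next
    case False
    have "finite T" "x \<notin> T"
      using T(1) Cons.prems(2) finite_subset by auto
    with False T v show ?thesis
      by (intro Cons.prems(1) [of "insert x T"]) auto
  qed
qed simp

lemma sum_eq_lincomb_masks:
  assumes "distinct xs" and "T \<subseteq> set xs"
  obtains v where "v \<in> set (masks (length xs))" and "\<Sum>T = lincomb v xs"
  using assms
proof (induction xs arbitrary: T thesis)
  case (Cons x xs)
  then obtain v where v: "v \<in> set (masks (length xs))" "\<Sum>(T - {x}) = lincomb v xs"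
    by (metis Diff_subset_conv distinct.simps(2) insert_is_Un list.simps(15))
  have "finite T"
    using Cons.prems(3) finite_subset by auto
  show ?case
  proof (cases "x \<in> T")
    case True
    with \<open>finite T\<close> have "\<Sum>T = x + \<Sum>(T - {x})"
      by (rule sum.remove)
    with v show ?thesis
      by (intro Cons.prems(1) [of "1 # v"]) auto
  next
    case False
    with v show ?thesis
      by (intro Cons.prems(1) [of "0 # v"]) auto
  qed
qed simp

lemma lincomb_image_masks:
  assumes "distinct xs"
  shows "(\<lambda>v. lincomb v xs) ` set (masks (length xs)) = insert 0 (subset_sums (set xs))"
proof
  show "(\<lambda>v. lincomb v xs) ` set (masks (length xs)) \<subseteq> insert 0 (subset_sums (set xs))"
  proof (rule image_subsetI)
    fix v
    assume "v \<in> set (masks (length xs))"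
    with assms obtain T where "T \<subseteq> set xs" "lincomb v xs = \<Sum>T"
      by (rule lincomb_masks_eq_sum)
    then show "lincomb v xs \<in> insert 0 (subset_sums (set xs))"
      unfolding subset_sums_def by (cases "T = {}") auto
  qed
  show "insert 0 (subset_sums (set xs)) \<subseteq> (\<lambda>v. lincomb v xs) ` set (masks (length xs))"
  proof
    fix s
    assume "s \<in> insert 0 (subset_sums (set xs))"
    then obtain T where T: "T \<subseteq> set xs" "s = \<Sum>T"
      unfolding subset_sums_def by (auto intro: that [of "{}"])
    obtain v where "v \<in> set (masks (length xs))" "\<Sum>T = lincomb v xs"
      using assms T(1) by (rule sum_eq_lincomb_masks)
    with T(2) show "s \<in> (\<lambda>v. lincomb v xs) ` set (masks (length xs))"
      by (intro image_eqI [of _ _ v]) simp_all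
  qed
qed

lemma lincomb_masks_nonzero:
  assumes "distinct xs" and "zero_sum_free (set xs)" and "v \<in> set (masks (length xs))" and "\<not> is_zero v"
  shows "lincomb v xs \<noteq> 0"
proof -
  obtain T where "T \<subseteq> set xs" "lincomb v xs = \<Sum>T" "T \<noteq> {}"
    using lincomb_masks_eq_sum [OF assms(1,3)] assms(4) by metis
  then have "lincomb v xs \<in> subset_sums (set xs)"
    unfolding subset_sums_def by auto
  with assms(2) show ?thesis
    unfolding zero_sum_free_def by metis
qed

section \<open>A certificate checker\<close>

text \<open>A set of integer vectors, branching on one coordinate at a time. Every step makes 210
  lookups, one per pair of the 21 sums, in a table filled by at least 156 insertions, and evaluation
  is by rewriting; this makes fast membership worthwhile.\<close>

datatype trie = Trie bool "(int \<times> trie) list"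

primrec update :: "int \<Rightarrow> (trie \<Rightarrow> trie) \<Rightarrow> (int \<times> trie) list \<Rightarrow> (int \<times> trie) list" where
  "update a f [] = [(a, f (Trie False []))]"
| "update a f (p # ts) = (if fst p = a then (a, f (snd p)) # ts else p # update a f ts)"

primrec ins :: "int list \<Rightarrow> trie \<Rightarrow> trie" where
  "ins [] t = (case t of Trie b ts \<Rightarrow> Trie True ts)"
| "ins (a # v) t = (case t of Trie b ts \<Rightarrow> Trie b (update a (ins v) ts))"

primrec mem :: "int list \<Rightarrow> trie \<Rightarrow> bool" where
  "mem [] t = (case t of Trie b ts \<Rightarrow> b)"
| "mem (a # v) t = (case t of Trie b ts \<Rightarrow> (case map_of ts a of None \<Rightarrow> False | Some s \<Rightarrow> mem v s))"

lemma mem_empty [simp]: "\<not> mem v (Trie False [])"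
  by (cases v) simp_all

lemma map_of_update:
  "map_of (update a f ts) b =
    (if b = a then Some (f (case map_of ts a of None \<Rightarrow> Trie False [] | Some s \<Rightarrow> s)) else map_of ts b)"
  by (induction ts) auto

lemma mem_ins: "mem w (ins v t) \<longleftrightarrow> w = v \<or> mem w t"
proof (induction v arbitrary: w t)
  case Nil
  then show ?case
    by (cases w; cases t) auto
next
  case (Cons a v)
  then show ?case
    by (cases w; cases t) (auto simp: map_of_update split: option.splits)
qed

text \<open>Both signs are stored because \<open>all_pairs\<close> visits each pair in one order
  only. Comparing normal forms makes membership a test modulo the relations.\<close>

primrec table :: "int list list \<Rightarrow> int list list \<Rightarrow> trie" where
  "table rs [] = Trie False []"
| "table rs (d # ds) = ins (reduce rs d) (ins (reduce rs (vdiff [] d)) (table rs ds))"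

lemma lincomb_mem_table:
  assumes "\<forall>r\<in>set rs. lincomb r xs = 0" and "\<forall>d\<in>set ds. lincomb d xs \<noteq> 0" and "mem v (table rs ds)"
  shows "lincomb v xs \<noteq> 0"
  using assms(2,3)
  by (induction ds) (auto simp: mem_ins lincomb_reduce [OF assms(1)] lincomb_vdiff)

primrec all_pairs :: "('b \<Rightarrow> 'b \<Rightarrow> bool) \<Rightarrow> 'b list \<Rightarrow> bool" where
  "all_pairs f [] \<longleftrightarrow> True"
| "all_pairs f (x # xs) \<longleftrightarrow> list_all (f x) xs \<and> all_pairs f xs"

definition separated :: "int list list \<Rightarrow> trie \<Rightarrow> int list list \<Rightarrow> bool" where
  "separated rs t vs \<longleftrightarrow> all_pairs (\<lambda>u v. mem (reduce rs (vdiff u v)) t) vs"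

text \<open>Reduction by any selection of vanishing rows preserves values, so \<open>p\<close> is
  free: the differences may be reduced by fewer rows than the table.\<close>

lemma distinct_lincomb_separated:
  assumes "\<forall>r\<in>set rs. lincomb r xs = 0" and "\<forall>d\<in>set ds. lincomb d xs \<noteq> 0"
    and "separated (filter p rs) (table rs ds) vs"
  shows "distinct (map (\<lambda>v. lincomb v xs) vs)"
proof -
  have p: "\<forall>r\<in>set (filter p rs). lincomb r xs = 0"
    using assms(1) by simp
  have "lincomb u xs \<noteq> lincomb v xs" if "mem (reduce (filter p rs) (vdiff u v)) (table rs ds)" for u v
    using lincomb_mem_table [OF assms(1,2) that] by (auto simp: lincomb_reduce [OF p] lincomb_vdiff)
  then show ?thesis
    using assms(3) unfolding separated_def
    by (induction vs) (fastforce simp: list_all_iff)+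
qed

text \<open>The vectors that cannot vanish for any admissible list. The head of
  \<open>masks 6\<close> is the zero vector, the empty sum, which \<open>tl\<close> drops.\<close>

definition base :: "int list list" where
  "base = tl (masks 6) @ unit_diffs 6"

lemma lincomb_base:
  assumes "length xs = 6" and "distinct xs" and "zero_sum_free (set xs)"
  shows "\<forall>d\<in>set base. lincomb d xs \<noteq> 0"
proof -
  have "list_all (\<lambda>v. \<not> is_zero v) (tl (masks 6))"
    by code_simp
  moreover have "set (tl (masks 6)) \<subseteq> set (masks 6)"
    by (metis list.set_sel(2) subsetI tl_Nil)
  ultimately show ?thesis
    using lincomb_masks_nonzero [OF assms(2,3)] lincomb_unit_diffs [OF assms(2)]
    unfolding base_def assms(1) list_all_iff by auto
qed

text \<open>\<open>P\<close> depends only on the set, not on its enumeration; this is what allows a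
  certificate to reorder the elements before citing an earlier lattice. Relations incompatible with
  the other hypotheses force every \<open>P\<close>.\<close>

definition forces :: "('a::ab_group_add set \<Rightarrow> bool) \<Rightarrow> int list list \<Rightarrow> bool" where
  "forces P rs \<longleftrightarrow> (\<forall>xs. length xs = 6 \<and> distinct xs \<and> zero_sum_free (set xs)
    \<and> card (subset_sums (set xs)) = 19 \<and> (\<forall>r\<in>set rs. lincomb r xs = 0) \<longrightarrow> P (set xs))"

definition edge :: "int \<Rightarrow> int \<Rightarrow> int list" where
  "edge j k = vdiff (bits 6 j) (bits 6 k)"

definition is_perm :: "nat list \<Rightarrow> bool" where
  "is_perm q \<longleftrightarrow> length q = 6 \<and> distinct q \<and> list_all (\<lambda>i. i < 6) q"

text \<open>
  An entry \<open>(g, es)\<close> of a certificate names relations \<open>g\<close> already treated. Each \<open>(j, k, q)\<close> in \<open>es\<close>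
  asserts: if the subset sums with bit masks \<open>j\<close> and \<open>k\<close> coincide, then the list reordered by \<open>q\<close>
  satisfies \<open>g\<close>.
\<close>

type_synonym cert = "(int list list \<times> (int \<times> int \<times> nat list) list) list"

definition edges_ok :: "int list list \<Rightarrow> cert \<Rightarrow> bool" where
  "edges_ok rs cs \<longleftrightarrow> list_all (\<lambda>(g, es). list_all (\<lambda>(j, k, q). is_perm q \<and>
     list_all (in_span rs (reduce rs (edge j k))) (map (scatter q) g)) es) cs"

definition cert_edges :: "cert \<Rightarrow> int list list" where
  "cert_edges cs = concat (map (\<lambda>(g, es). map (\<lambda>(j, k, q). edge j k) es) cs)"

text \<open>
  The 21 subset sums with bit masks \<open>w\<close> cannot be pairwise distinct. Coordinates with pivot 1 already
  vanish in a difference of reduced vectors, so only the other rows are needed to reduce it again.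
\<close>

definition check :: "int list list \<Rightarrow> int list \<Rightarrow> cert \<Rightarrow> bool" where
  "check rs w cs \<longleftrightarrow> length w = 21 \<and> edges_ok rs cs
    \<and> separated (filter (\<lambda>r. lead r \<noteq> 1) rs) (table rs (cert_edges cs @ base)) (map (\<lambda>k. reduce rs (bits 6 k)) w)"

text \<open>Arguing by contradiction puts both kinds of coincidence on the same footing: if
  \<open>P\<close> fails, a coincidence leading to a lattice already treated is as impossible as one
  excluded by \<open>base\<close>. Its edge then joins the nonvanishing vectors, and a single table
  separates all 21 sums, one more than the 19 sums and 0 allow.\<close>

lemma forces_check:
  assumes "check rs w cs" and "\<forall>c\<in>set cs. forces P (fst c)"
  shows "forces P rs"
  unfolding forces_def
proof (intro allI impI, rule ccontr)
  fix xs :: "'a list"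
  assume xs: "length xs = 6 \<and> distinct xs \<and> zero_sum_free (set xs)
    \<and> card (subset_sums (set xs)) = 19 \<and> (\<forall>r\<in>set rs. lincomb r xs = 0)"
    and "\<not> P (set xs)"
  then have rs: "\<forall>r\<in>set rs. lincomb r xs = 0"
    by blast
  have "lincomb (edge j k) xs \<noteq> 0" if c: "(g, es) \<in> set cs" and e: "(j, k, q) \<in> set es" for g es j k q
  proof
    assume 0: "lincomb (edge j k) xs = 0"
    have q: "is_perm q" and span: "\<forall>r\<in>set g. in_span rs (reduce rs (edge j k)) (scatter q r)"
      using assms(1) c e unfolding check_def edges_ok_def list_all_iff by fastforce+
    have q': "\<forall>i\<in>set q. i < length xs"
      using q xs unfolding is_perm_def list_all_iff by simp
    let ?ys = "map ((!) xs) q"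
    have "length ?ys = 6"
      using q unfolding is_perm_def by simp
    have "distinct ?ys"
      using q q' xs unfolding is_perm_def distinct_map by (auto simp: inj_on_def nth_eq_iff_index_eq)
    have "set ?ys = set xs"
    proof (rule card_subset_eq)
      show "set ?ys \<subseteq> set xs"
        using q' by auto
      show "card (set ?ys) = card (set xs)"
        using \<open>distinct ?ys\<close> \<open>length ?ys = 6\<close> xs distinct_card by metis
    qed simp
    moreover have "\<forall>r\<in>set g. lincomb r ?ys = 0"
    proof
      fix r
      assume "r \<in> set g"
      with span have "lincomb (scatter q r) xs = 0"
        using lincomb_in_span [OF rs, of "reduce rs (edge j k)"] 0
        by (simp add: lincomb_reduce [OF rs])
      then show "lincomb r ?ys = 0"
        by (simp add: lincomb_scatter [OF q'])
    qed
    ultimately have "P (set xs)"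
      using assms(2) c xs \<open>distinct ?ys\<close> \<open>length ?ys = 6\<close> unfolding forces_def by (metis fst_conv)
    with \<open>\<not> P (set xs)\<close> show False ..
  qed
  then have "\<forall>d\<in>set (cert_edges cs @ base). lincomb d xs \<noteq> 0"
    using lincomb_base xs unfolding cert_edges_def by fastforce
  then have "distinct (map (\<lambda>v. lincomb v xs) (map (\<lambda>k. reduce rs (bits 6 k)) w))"
    using assms(1) unfolding check_def
    by (intro distinct_lincomb_separated [OF rs, of "cert_edges cs @ base" "\<lambda>r. lead r \<noteq> 1"]) simp_all
  then have "card (set (map (\<lambda>k. lincomb (bits 6 k) xs) w)) = 21"
    using assms(1) distinct_card [of "map (\<lambda>k. lincomb (bits 6 k) xs) w"]
    unfolding check_def by (simp add: comp_def lincomb_reduce [OF rs])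
  moreover have "set (map (\<lambda>k. lincomb (bits 6 k) xs) w) \<subseteq> insert 0 (subset_sums (set xs))"
    using xs bits_in_masks [of 6] lincomb_image_masks [of xs] by auto
  moreover have fin: "finite (subset_sums (set xs))"
    using xs by (intro card_ge_0_finite) simp
  moreover have "card (insert 0 (subset_sums (set xs))) \<le> 20"
    using xs fin by (simp add: card_insert_if)
  ultimately show False
    using card_mono [of "insert 0 (subset_sums (set xs))" "set (map (\<lambda>k. lincomb (bits 6 k) xs) w)"]
    by (simp del: set_map)
qed


section \<open>Chaining certificates\<close>

type_synonym step =
  "int list list \<times> int list \<times> (nat \<times> (int \<times> int \<times> nat list) list) list"

text \<open>The numbers in a certificate are positions in \<open>fs\<close>, which grows by one
  lattice per step, so only lattices treated before can be cited. Starting from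
  \<open>families\<close>, positions 0 to 5 are the families, the steps follow from 6, and the zero
  lattice ends up at 86.\<close>

primrec derives :: "int list list list \<Rightarrow> step list \<Rightarrow> bool" where
  "derives fs [] \<longleftrightarrow> True"
| "derives fs (s # ss) \<longleftrightarrow> (case s of (rs, w, cs) \<Rightarrow>
     list_all (\<lambda>(k, es). k < length fs) cs \<and> check rs w (map (\<lambda>(k, es). (fs ! k, es)) cs)
     \<and> derives (fs @ [rs]) ss)"

lemma forces_derives:
  assumes "derives fs ss" and "\<forall>f\<in>set fs. forces P f"
  shows "\<forall>f\<in>set (fs @ map fst ss). forces P f"
  using assms
proof (induction ss arbitrary: fs)
  case (Cons s ss)
  obtain rs w cs where s: "s = (rs, w, cs)"
    by (cases s)
  have "forces P rs"
    using Cons.prems unfolding s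
    by (intro forces_check [of rs w "map (\<lambda>(k, es). (fs ! k, es)) cs"]) (auto simp: list_all_iff)
  then show ?case
    using Cons.IH [of "fs @ [rs]"] Cons.prems unfolding s by auto
qed simp

section \<open>Lattices that leave exactly twenty values\<close>

definition exact :: "int list list \<Rightarrow> bool" where
  "exact rs \<longleftrightarrow> (let vs = remdups (map (reduce rs) (masks 6))
     in length vs = 20 \<and> separated (filter (\<lambda>r. lead r \<noteq> 1) rs) (table rs base) vs)"

text \<open>The 64 masks have only 20 normal forms, which bounds the number of values from above;
  separation of these forms bounds it from below. One of the 20 values is the empty sum 0, which
  zero-sum freeness keeps out of \<open>subset_sums\<close>.\<close>

lemma card_subset_sums_exact:
  assumes "length xs = 6" and "distinct xs" and "zero_sum_free (set xs)"
    and rs: "\<forall>r\<in>set rs. lincomb r xs = 0" and "exact rs"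
  shows "card (subset_sums (set xs)) = 19"
proof -
  let ?vs = "remdups (map (reduce rs) (masks 6))"
  have "distinct (map (\<lambda>v. lincomb v xs) ?vs)"
    using assms(5) lincomb_base [OF assms(1-3)] unfolding exact_def Let_def
    by (intro distinct_lincomb_separated [OF rs, of base "\<lambda>r. lead r \<noteq> 1"]) simp_all
  then have "card (set (map (\<lambda>v. lincomb v xs) ?vs)) = 20"
    using distinct_card assms(5) unfolding exact_def Let_def by (metis length_map)
  moreover have "set (map (\<lambda>v. lincomb v xs) ?vs) = insert 0 (subset_sums (set xs))"
    using lincomb_image_masks [OF assms(2)] by (simp add: assms(1) image_image lincomb_reduce [OF rs])
  moreover have "0 \<notin> subset_sums (set xs)"
    using assms(3) unfolding zero_sum_free_def .
  ultimately have "card (insert 0 (subset_sums (set xs))) = 20"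
    by metis
  \<comment> \<open>An infinite set has cardinality 0 by convention, so the value 20 also rules out
    that case.\<close>
  with \<open>0 \<notin> _\<close> show ?thesis
    by (cases "finite (subset_sums (set xs))") simp_all
qed

section \<open>The five families\<close>

text \<open>The right-hand side of the theorem verbatim, packaged as a predicate of the set so that
  it can be the property to be forced.\<close>

definition listed :: "'a::ab_group_add set \<Rightarrow> bool" where
  "listed S \<longleftrightarrow>
    (\<exists>x1 x2 x3.
      (S = {x1, x2, x3, x1 + x3, x2 + x3, x1 + x2 + x3}
        \<and> add_ord x1 = 2 \<and> 2 \<cdot> x2 \<in> group_closure {x1})
    \<or> (S = {x1, x2, 2 \<cdot> x2, 3 \<cdot> x2, x1 + x2, x1 + 2 \<cdot> x2}
        \<and> add_ord x1 = 2)
    \<or> (S = {- (2 \<cdot> x1), x1, 3 \<cdot> x1, 4 \<cdot> x1, 5 \<cdot> x1, 6 \<cdot> x1}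
        \<and> add_ord x1 = 20)
    \<or> (S = {- (3 \<cdot> x1), x1, 4 \<cdot> x1, 5 \<cdot> x1, 9 \<cdot> x1, 12 \<cdot> x1}
        \<and> add_ord x1 = 20)
    \<or> (S = {x1, x2, x1 + x2, x1 + 2 \<cdot> x2, 2 \<cdot> x1 + x2, 4 \<cdot> x1 + 4 \<cdot> x2}
        \<and> 2 \<cdot> x1 = 2 \<cdot> x2 \<and> add_ord x1 = 10 \<and> add_ord x2 = 10))"

text \<open>
  Each family is written as relations on the reversed list of its elements, so that the rows are triangular;
  the first case splits into \<open>2 \<cdot> x2 = 0\<close> and \<open>2 \<cdot> x2 = x1\<close>.
\<close>

definition families :: "int list list list" where
  "families =
   [[[1, 0, 0, - 1, - 1, - 1],
     [0, 1, 0, - 1, - 1, 0],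
     [0, 0, 1, - 1, 0, - 1],
     [0, 0, 0, 0, 2, 0],
     [0, 0, 0, 0, 0, 2]],
    [[1, 0, 0, - 1, - 1, - 1],
     [0, 1, 0, - 1, - 1, 0],
     [0, 0, 1, - 1, 0, - 1],
     [0, 0, 0, 0, 2, - 1],
     [0, 0, 0, 0, 0, 2]],
    [[1, 0, 0, 0, - 1, - 2],
     [0, 1, 0, 0, - 1, - 1],
     [0, 0, 1, 0, 0, - 3],
     [0, 0, 0, 1, 0, - 2],
     [0, 0, 0, 0, 2, 0]],
    [[1, 0, 0, 0, 0, - 6],
     [0, 1, 0, 0, 0, - 5],
     [0, 0, 1, 0, 0, - 4],
     [0, 0, 0, 1, 0, - 3],
     [0, 0, 0, 0, 1, 2],
     [0, 0, 0, 0, 0, 20]],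
    [[1, 0, 0, 0, 0, - 12],
     [0, 1, 0, 0, 0, - 9],
     [0, 0, 1, 0, 0, - 5],
     [0, 0, 0, 1, 0, - 4],
     [0, 0, 0, 0, 1, 3],
     [0, 0, 0, 0, 0, 20]],
    [[1, 0, 0, 0, - 4, - 4],
     [0, 1, 0, 0, - 1, - 2],
     [0, 0, 1, 0, - 2, - 1],
     [0, 0, 0, 1, - 1, - 1],
     [0, 0, 0, 0, 2, - 2],
     [0, 0, 0, 0, 0, 10]]]"

lemma int_mult_numeral [simp]: "numeral k \<odot> x = (numeral k :: nat) \<cdot> x"
  by (simp add: int_mult_def)

lemma int_mult_minus_numeral [simp]: "(- numeral k) \<odot> x = - ((numeral k :: nat) \<cdot> x)"
  by (simp add: int_mult_def)

lemma int_mult_minus_1 [simp]: "(- 1) \<odot> x = - x"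
  by (simp add: int_mult_minus_left)

lemma add_ord_eqI:
  assumes "n > 0" and "n \<cdot> x = 0" and "\<And>m. 0 < m \<Longrightarrow> m < n \<Longrightarrow> m \<cdot> x \<noteq> 0"
  shows "add_ord x = n"
proof -
  have "(LEAST n. n > 0 \<and> n \<cdot> x = 0) = n"
    using assms by (intro Least_equality) (auto simp: not_less [symmetric])
  with assms(1,2) show ?thesis
    unfolding add_ord_def by auto
qed

text \<open>For infinite order this is the convention \<open>add_ord x = 0\<close>.\<close>

lemma nat_mult_add_ord: "add_ord x \<cdot> x = 0"
proof (cases "\<exists>n>0. n \<cdot> x = 0")
  case True
  then show ?thesis
    using LeastI_ex [of "\<lambda>n. n > 0 \<and> n \<cdot> x = 0"] unfolding add_ord_def by auto
next
  case False
  then show ?thesis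
    unfolding add_ord_def by (simp only: if_False nat_mult.simps)
qed

lemma group_closure_singleton_order_2:
  assumes "2 \<cdot> x = 0"
  shows "group_closure {x} = {0, x}"
proof
  have "- x = x"
    using assms by (simp add: numeral_2_eq_2 neg_eq_iff_add_eq_0)
  have "y \<in> {0, x}" if "y \<in> group_closure {x}" for y
    using that by induction (use \<open>- x = x\<close> in auto)
  then show "group_closure {x} \<subseteq> {0, x}"
    by blast
  show "{0, x} \<subseteq> group_closure {x}"
    by (auto intro: group_closure.base)
qed

lemma list_length_6E:
  assumes "length xs = 6"
  obtains f e d c b a where "xs = [f, e, d, c, b, a]"
  using assms by (auto simp: numeral_eq_Suc length_Suc_conv)

definition multiples_nonzero :: "int list list \<Rightarrow> (int \<Rightarrow> int list) \<Rightarrow> int \<Rightarrow> bool" where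
  "multiples_nonzero rs g n \<longleftrightarrow> list_all (\<lambda>k. mem (reduce rs (g k)) (table rs base)) [1..n - 1]"

text \<open>Recovers an exact order from relations that only bound it: each smaller positive
  multiple has the normal form of plus or minus a nonempty subset sum or a difference of two
  elements, and so is nonzero.\<close>

lemma add_ord_eq_multiples_nonzero:
  assumes "length xs = 6" and "distinct xs" and "zero_sum_free (set xs)"
    and rs: "\<forall>r\<in>set rs. lincomb r xs = 0" and g: "\<And>k. lincomb (g k) xs = k \<odot> x"
    and "multiples_nonzero rs g (int n)" and "n > 0" and "n \<cdot> x = 0"
  shows "add_ord x = n"
proof (rule add_ord_eqI)
  fix m
  assume "0 < m" "m < n"
  then have "mem (reduce rs (g (int m))) (table rs base)"
    using assms(6) unfolding multiples_nonzero_def list_all_iff by simp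
  from lincomb_mem_table [OF rs lincomb_base [OF assms(1-3)] this]
  show "m \<cdot> x \<noteq> 0"
    by (simp add: lincomb_reduce [OF rs] g int_mult_of_nat)
qed fact+

lemma exact_families: "list_all exact families"
  by code_simp

text \<open>The elements tested are those whose order is prescribed: \<open>x1\<close> throughout
  and also \<open>x2\<close> in the last family. In family 2 the list ends in \<open>x1, x2\<close>,
  hence the multiples of the last coordinate but one.\<close>

lemma multiples_nonzero_families:
  "multiples_nonzero (families ! 0) (\<lambda>k. [0, 0, 0, 0, 0, k]) 2"
  "multiples_nonzero (families ! 1) (\<lambda>k. [0, 0, 0, 0, 0, k]) 2"
  "multiples_nonzero (families ! 2) (\<lambda>k. [0, 0, 0, 0, k, 0]) 2"
  "multiples_nonzero (families ! 3) (\<lambda>k. [0, 0, 0, 0, 0, k]) 20"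
  "multiples_nonzero (families ! 4) (\<lambda>k. [0, 0, 0, 0, 0, k]) 20"
  "multiples_nonzero (families ! 5) (\<lambda>k. [0, 0, 0, 0, 0, k]) 10"
  "multiples_nonzero (families ! 5) (\<lambda>k. [0, 0, 0, 0, k, 0]) 10"
  by code_simp+


section \<open>From the relations of a family to its listed form\<close>

lemma forces_families_0: "forces listed (families ! 0)"
  unfolding forces_def
proof (intro allI impI, elim conjE)
  fix xs :: "'a list"
  assume xs: "length xs = 6" "distinct xs" "zero_sum_free (set xs)" "\<forall>r\<in>set (families ! 0). lincomb r xs = 0"
  obtain f e d c b a where eq: "xs = [f, e, d, c, b, a]"
    using xs(1) by (rule list_length_6E)
  have "f = a + b + c" "e = b + c" "d = a + c" "2 \<cdot> b = 0" "2 \<cdot> a = 0"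
    using xs(4) by (simp_all add: families_def eq add_eq_0_iff2 ac_simps)
  moreover have "add_ord a = 2"
    using calculation xs multiples_nonzero_families(1)
    by (intro add_ord_eq_multiples_nonzero [of xs]) (simp_all add: eq)
  ultimately show "listed (set xs)"
    unfolding listed_def eq
    by (intro exI [of _ a] exI [of _ b] exI [of _ c] disjI1) auto
qed

lemma forces_families_1: "forces listed (families ! 1)"
  unfolding forces_def
proof (intro allI impI, elim conjE)
  fix xs :: "'a list"
  assume xs: "length xs = 6" "distinct xs" "zero_sum_free (set xs)" "\<forall>r\<in>set (families ! 1). lincomb r xs = 0"
  obtain f e d c b a where eq: "xs = [f, e, d, c, b, a]"
    using xs(1) by (rule list_length_6E)
  have "f = a + b + c" "e = b + c" "d = a + c" "2 \<cdot> b = a" "2 \<cdot> a = 0"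
    using xs(4) by (simp_all add: families_def eq add_eq_0_iff2 ac_simps)
  moreover have "add_ord a = 2"
    using calculation xs multiples_nonzero_families(2)
    by (intro add_ord_eq_multiples_nonzero [of xs]) (simp_all add: eq)
  ultimately show "listed (set xs)"
    unfolding listed_def eq
    by (intro exI [of _ a] exI [of _ b] exI [of _ c] disjI1) (auto intro: group_closure.base)
qed

lemma forces_families_2: "forces listed (families ! 2)"
  unfolding forces_def
proof (intro allI impI, elim conjE)
  fix xs :: "'a list"
  assume xs: "length xs = 6" "distinct xs" "zero_sum_free (set xs)" "\<forall>r\<in>set (families ! 2). lincomb r xs = 0"
  obtain f e d c b a where eq: "xs = [f, e, d, c, b, a]"
    using xs(1) by (rule list_length_6E)
  have "f = b + 2 \<cdot> a" "e = b + a" "d = 3 \<cdot> a" "c = 2 \<cdot> a" "2 \<cdot> b = 0"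
    using xs(4) by (simp_all add: families_def eq add_eq_0_iff2 ac_simps)
  moreover have "add_ord b = 2"
    using calculation xs multiples_nonzero_families(3)
    by (intro add_ord_eq_multiples_nonzero [of xs]) (simp_all add: eq)
  ultimately show "listed (set xs)"
    unfolding listed_def eq
    by (intro exI [of _ b] exI [of _ a] disjI2 [OF disjI1]) auto
qed

lemma forces_families_3: "forces listed (families ! 3)"
  unfolding forces_def
proof (intro allI impI, elim conjE)
  fix xs :: "'a list"
  assume xs: "length xs = 6" "distinct xs" "zero_sum_free (set xs)" "\<forall>r\<in>set (families ! 3). lincomb r xs = 0"
  obtain f e d c b a where eq: "xs = [f, e, d, c, b, a]"
    using xs(1) by (rule list_length_6E)
  have "f = 6 \<cdot> a" "e = 5 \<cdot> a" "d = 4 \<cdot> a" "c = 3 \<cdot> a" "b = - (2 \<cdot> a)" "20 \<cdot> a = 0"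
    using xs(4) by (simp_all add: families_def eq add_eq_0_iff2)
  moreover have "add_ord a = 20"
    using calculation xs multiples_nonzero_families(4)
    by (intro add_ord_eq_multiples_nonzero [of xs]) (simp_all add: eq)
  ultimately show "listed (set xs)"
    unfolding listed_def eq
    by (intro exI [of _ a] exI disjI2 [OF disjI2 [OF disjI1]]) auto
qed

lemma forces_families_4: "forces listed (families ! 4)"
  unfolding forces_def
proof (intro allI impI, elim conjE)
  fix xs :: "'a list"
  assume xs: "length xs = 6" "distinct xs" "zero_sum_free (set xs)" "\<forall>r\<in>set (families ! 4). lincomb r xs = 0"
  obtain f e d c b a where eq: "xs = [f, e, d, c, b, a]"
    using xs(1) by (rule list_length_6E)
  have "f = 12 \<cdot> a" "e = 9 \<cdot> a" "d = 5 \<cdot> a" "c = 4 \<cdot> a" "b = - (3 \<cdot> a)" "20 \<cdot> a = 0"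
    using xs(4) by (simp_all add: families_def eq add_eq_0_iff2)
  moreover have "add_ord a = 20"
    using calculation xs multiples_nonzero_families(5)
    by (intro add_ord_eq_multiples_nonzero [of xs]) (simp_all add: eq)
  ultimately show "listed (set xs)"
    unfolding listed_def eq
    by (intro exI [of _ a] exI disjI2 [OF disjI2 [OF disjI2 [OF disjI1]]]) auto
qed

lemma forces_families_5: "forces listed (families ! 5)"
  unfolding forces_def
proof (intro allI impI, elim conjE)
  fix xs :: "'a list"
  assume xs: "length xs = 6" "distinct xs" "zero_sum_free (set xs)" "\<forall>r\<in>set (families ! 5). lincomb r xs = 0"
  obtain f e d c b a where eq: "xs = [f, e, d, c, b, a]"
    using xs(1) by (rule list_length_6E)
  have "f = 4 \<cdot> a + 4 \<cdot> b" "e = 2 \<cdot> a + b" "d = a + 2 \<cdot> b" "c = a + b" "2 \<cdot> a = 2 \<cdot> b" "10 \<cdot> a = 0"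
    using xs(4) by (simp_all add: families_def eq add_eq_0_iff2 ac_simps)
  \<comment> \<open>Five times the relation \<open>2 \<cdot> b = 2 \<cdot> a\<close> gives
    \<open>10 \<cdot> b = 10 \<cdot> a = 0\<close>. The span test finds this from the rows alone,
    with the zero vector \<open>[]\<close> as extra relation.\<close>
  moreover have "10 \<cdot> b = 0"
    using lincomb_in_span [OF xs(4), of "[]" "[0, 0, 0, 0, 10, 0]"]
    by (simp add: eq families_def in_span_def Let_def)
  moreover have "add_ord a = 10"
    using calculation xs multiples_nonzero_families(6)
    by (intro add_ord_eq_multiples_nonzero [of xs]) (simp_all add: eq)
  moreover have "add_ord b = 10"
    using calculation xs multiples_nonzero_families(7)
    by (intro add_ord_eq_multiples_nonzero [of xs]) (simp_all add: eq)
  ultimately show "listed (set xs)"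
    unfolding listed_def eq
    by (intro exI [of _ a] exI [of _ b] exI disjI2) auto
qed

lemma forces_families: "\<forall>f\<in>set families. forces listed f"
proof -
  have "set families = {families ! 0, families ! 1, families ! 2, families ! 3, families ! 4, families ! 5}"
    unfolding families_def by simp
  then show ?thesis
    using forces_families_0 forces_families_1 forces_families_2 forces_families_3
      forces_families_4 forces_families_5 by auto
qed

section \<open>Every listed set has nineteen sums\<close>

lemma card_subset_sums_family:
  assumes "card (set xs) = 6" and "zero_sum_free (set xs)" and "length xs = 6"
    and "i < 6" and "\<forall>r\<in>set (families ! i). lincomb r xs = 0"
  shows "card (subset_sums (set xs)) = 19"
proof (rule card_subset_sums_exact)
  show "distinct xs"
    using assms(1,3) by (intro card_distinct) simp
  show "exact (families ! i)"
    using exact_families assms(4) unfolding list_all_length by (simp add: families_def)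
qed fact+

lemma card_subset_sums_listed:
  fixes S :: "'a::ab_group_add set"
  assumes "card S = 6" and "zero_sum_free S" and "listed S"
  shows "card (subset_sums S) = 19"
proof -
  have *: ?thesis if "S = set xs" "length xs = 6" "i < 6" "\<forall>r\<in>set (families ! i). lincomb r xs = 0" for xs i
    using card_subset_sums_family [of xs i] assms(1,2) that by simp
  from assms(3) [unfolded listed_def] show ?thesis
  proof (elim exE disjE conjE)
    fix a b c
    assume S: "S = {a, b, c, a + c, b + c, a + b + c}"
      and ord: "add_ord a = 2" and b: "2 \<cdot> b \<in> group_closure {a}"
    have a: "2 \<cdot> a = 0"
      using nat_mult_add_ord [of a] ord by simp
    \<comment> \<open>The subgroup generated by an element of order 2 is \<open>{0, a}\<close>; the
      two alternatives are families 0 and 1.\<close>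
    with b have "2 \<cdot> b = 0 \<or> 2 \<cdot> b = a"
      by (simp add: group_closure_singleton_order_2)
    then show ?thesis
    proof
      assume "2 \<cdot> b = 0"
      with a S show ?thesis
        by (intro * [of "[a + b + c, b + c, a + c, c, b, a]" 0]) (auto simp: families_def)
    next
      assume "2 \<cdot> b = a"
      with a S show ?thesis
        by (intro * [of "[a + b + c, b + c, a + c, c, b, a]" 1]) (auto simp: families_def)
    qed
  next
    fix a b
    assume S: "S = {a, b, 2 \<cdot> b, 3 \<cdot> b, a + b, a + 2 \<cdot> b}" and ord: "add_ord a = 2"
    have "2 \<cdot> a = 0"
      using nat_mult_add_ord [of a] ord by simp
    with S show ?thesis
      by (intro * [of "[a + 2 \<cdot> b, a + b, 3 \<cdot> b, 2 \<cdot> b, a, b]" 2]) (auto simp: families_def)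
  next
    fix a
    assume S: "S = {- (2 \<cdot> a), a, 3 \<cdot> a, 4 \<cdot> a, 5 \<cdot> a, 6 \<cdot> a}" and ord: "add_ord a = 20"
    have "20 \<cdot> a = 0"
      using nat_mult_add_ord [of a] ord by simp
    with S show ?thesis
      by (intro * [of "[6 \<cdot> a, 5 \<cdot> a, 4 \<cdot> a, 3 \<cdot> a, - (2 \<cdot> a), a]" 3]) (auto simp: families_def)
  next
    fix a
    assume S: "S = {- (3 \<cdot> a), a, 4 \<cdot> a, 5 \<cdot> a, 9 \<cdot> a, 12 \<cdot> a}" and ord: "add_ord a = 20"
    have "20 \<cdot> a = 0"
      using nat_mult_add_ord [of a] ord by simp
    with S show ?thesis
      by (intro * [of "[12 \<cdot> a, 9 \<cdot> a, 5 \<cdot> a, 4 \<cdot> a, - (3 \<cdot> a), a]" 4]) (auto simp: families_def)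
  next
    fix a b
    assume S: "S = {a, b, a + b, a + 2 \<cdot> b, 2 \<cdot> a + b, 4 \<cdot> a + 4 \<cdot> b}"
      and "2 \<cdot> a = 2 \<cdot> b" and ord: "add_ord a = 10"
    moreover have "10 \<cdot> a = 0"
      using nat_mult_add_ord [of a] ord by simp
    ultimately show ?thesis
      by (intro * [of "[4 \<cdot> a + 4 \<cdot> b, 2 \<cdot> a + b, a + 2 \<cdot> b, a + b, b, a]" 5]) (auto simp: families_def)
  qed
qed

section \<open>The derivation\<close>

text \<open>Each entry gives an echelon basis of a lattice, the masks of 21 sums, and the
  coincidences to be passed on to earlier lattices. Where the certificate is \<open>[]\<close>, the
  relations alone already keep the 21 sums apart, so no set with 19 sums satisfies them.\<close>

definition steps1 :: "step list" where
  "steps1 = [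
    ([[1, - 1, - 1, 0, 0, 0], [0, 0, 0, 1, - 1, 1], [0, 0, 0, 0, 0, 2]], [0, 1, 2, 8, 9, 10, 11,
     15, 16, 17, 19, 23, 25, 27, 31, 32, 33, 34, 57, 59, 63], []),
    ([[1, 0, 0, 0, 0, - 12], [0, 1, 0, 0, 0, - 5], [0, 0, 1, 0, 0, 3], [0, 0, 0, 1, 0, 4], [0, 0,
     0, 0, 1, 7]], [0, 2, 4, 5, 6, 8, 9, 10, 12, 14, 15, 22, 23, 26, 27, 30, 31, 46, 47, 62, 63],
     [(4, [(47, 30, [3, 2, 1, 0, 5, 4])])]),
    ([[1, 0, 0, 0, - 6, 2], [0, 1, 0, 0, - 2, 1], [0, 0, 1, 0, 1, - 1], [0, 0, 0, 1, 4, - 1]], [0,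
     2, 4, 5, 6, 14, 15, 20, 21, 22, 26, 28, 30, 31, 37, 38, 46, 47, 54, 62, 63], [(7, [(37, 2,
     [0, 1, 5, 2, 3, 4])])]),
    ([[1, 0, 0, 0, 0, - 5], [0, 1, 0, 0, 1, - 5], [0, 0, 1, 0, 1, - 2], [0, 0, 0, 1, 1, 3], [0, 0,
     0, 0, 2, - 6]], [1, 2, 3, 4, 5, 6, 7, 13, 15, 16, 17, 20, 21, 24, 29, 31, 37, 45, 53, 60,
     63], []),
    ([[1, 0, 0, 0, - 1, - 1], [0, 1, 0, 0, 3, 3], [0, 0, 1, 1, 3, 3], [0, 0, 0, 2, 2, 2]], [0, 2,
     3, 4, 5, 7, 9, 11, 16, 18, 19, 20, 21, 22, 23, 25, 27, 31, 51, 57, 63], [(9, [(57, 31, [5, 2,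
     0, 4, 1, 3])])]),
    ([[1, 0, - 2, 0, - 1, - 1], [0, 1, - 1, 0, - 1, - 1], [0, 0, 0, 1, - 1, - 1]], [0, 1, 2, 3, 4,
     8, 9, 10, 11, 15, 32, 33, 34, 35, 36, 41, 43, 47, 57, 59, 63], [(8, [(43, 4, [4, 3, 2, 5, 1,
     0]), (59, 36, [5, 3, 2, 4, 1, 0])]), (10, [(59, 4, [3, 0, 2, 1, 4, 5])])]),
    ([[1, 0, 0, 0, 0, - 3], [0, 1, 0, 0, 0, 2], [0, 0, 1, 0, 0, 5], [0, 0, 0, 1, 0, 6], [0, 0, 0,
     0, 1, 7]], [0, 2, 3, 4, 6, 7, 8, 9, 10, 12, 14, 15, 18, 20, 22, 26, 28, 31, 34, 62, 63], []),
    ([[1, 0, 0, 0, - 2, 1], [0, 1, 0, 0, - 1, 1], [0, 0, 1, 0, 2, 1], [0, 0, 0, 1, 4, 0], [0, 0,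
     0, 0, 0, 3]], [0, 2, 4, 5, 6, 7, 8, 10, 13, 14, 15, 20, 21, 28, 29, 31, 37, 45, 52, 60, 63],
     []),
    ([[1, 0, 0, - 1, 0, - 2], [0, 1, 0, - 1, 0, - 1], [0, 0, 1, 1, 0, 4], [0, 0, 0, 0, 1, 2]], [0,
     1, 2, 3, 5, 7, 8, 9, 10, 11, 13, 14, 15, 25, 27, 32, 33, 35, 37, 59, 63], [(12, [(11, 5, [5,
     1, 3, 4, 2, 0]), (35, 14, [2, 4, 0, 1, 3, 5])]), (13, [(32, 27, [0, 5, 4, 2, 1, 3])])]),
    ([[1, - 1, 0, 0, 0, - 1], [0, 0, 1, 0, 0, - 3], [0, 0, 0, 1, 0, 2], [0, 0, 0, 0, 1, 5]], [0,
     1, 2, 3, 8, 9, 10, 11, 12, 13, 17, 18, 19, 28, 29, 31, 40, 43, 44, 60, 63], []),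
    ([[1, 0, 0, - 2, 0, - 1], [0, 1, 0, - 1, 0, - 1], [0, 0, 1, 2, 0, 3], [0, 0, 0, 0, 1, 2]], [0,
     1, 2, 5, 6, 7, 8, 9, 12, 13, 15, 19, 21, 23, 25, 33, 37, 38, 47, 53, 63], [(11, [(33, 21, [0,
     1, 3, 5, 2, 4])]), (14, [(21, 9, [2, 1, 0, 3, 4, 5])])]),
    ([[1, - 1, 0, 0, - 1, 0], [0, 0, 1, 0, 2, 0], [0, 0, 0, 1, 2, 1]], [0, 1, 2, 4, 5, 6, 7, 20,
     23, 32, 33, 34, 35, 37, 38, 39, 45, 47, 52, 55, 63], [(14, [(38, 23, [5, 0, 3, 1, 2, 4]),
     (45, 35, [3, 0, 5, 1, 2, 4])]), (15, [(38, 1, [0, 1, 5, 2, 3, 4])]), (16, [(35, 4, [3, 0, 5,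
     1, 2, 4]), (52, 23, [5, 0, 3, 1, 2, 4])])]),
    ([[1, 0, 0, - 2, 0, - 1], [0, 1, 0, - 1, 0, - 1], [0, 0, 1, 2, 1, 3], [0, 0, 0, 0, 2, 2]], [0,
     1, 2, 3, 5, 6, 7, 8, 9, 13, 15, 19, 22, 23, 31, 37, 39, 47, 53, 59, 63], [(6, [(22, 3, [1, 3,
     5, 0, 4, 2])]), (11, [(39, 31, [1, 5, 3, 4, 0, 2]), (59, 22, [4, 2, 0, 1, 3, 5])]), (17,
     [(37, 31, [1, 5, 4, 0, 3, 2]), (59, 6, [4, 2, 1, 3, 0, 5])])]),
    ([[1, 0, 0, 0, - 2, 2], [0, 1, 0, 0, - 2, 3], [0, 0, 1, 0, - 1, 2], [0, 0, 0, 1, 2, 0], [0, 0,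
     0, 0, 0, 4]], [3, 4, 5, 6, 9, 10, 11, 12, 13, 14, 15, 17, 21, 24, 26, 29, 31, 41, 44, 56,
     63], []),
    ([[1, 0, 0, - 1, - 1, 0], [0, 1, 0, - 1, - 1, 1], [0, 0, 1, 1, 1, 2], [0, 0, 0, 0, 0, 4]], [0,
     1, 2, 3, 5, 6, 7, 9, 15, 17, 18, 23, 25, 27, 29, 31, 37, 47, 55, 59, 63], [(11, [(17, 15, [0,
     4, 3, 5, 1, 2]), (23, 9, [0, 3, 4, 5, 1, 2]), (27, 5, [5, 2, 1, 0, 3, 4])]), (17, [(27, 6,
     [5, 2, 0, 3, 1, 4])]), (19, [(18, 15, [0, 1, 3, 2, 4, 5])])]),
    ([[1, - 1, 0, 0, - 1, 0], [0, 0, 1, 1, 2, 1], [0, 0, 0, 2, 2, 0]], [0, 1, 2, 8, 9, 10, 11, 24,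
     25, 27, 32, 33, 34, 35, 41, 45, 56, 57, 59, 60, 63], [(18, [(35, 8, [2, 0, 5, 1, 3, 4]), (56,
     27, [5, 0, 2, 1, 3, 4])]), (20, [(60, 27, [3, 1, 4, 2, 5, 0])])]),
    ([[1, - 1, - 1, 0, 0, 0], [0, 0, 0, 1, - 1, - 1]], [0, 1, 4, 8, 9, 11, 12, 13, 15, 16, 17, 25,
     31, 32, 33, 41, 47, 57, 59, 61, 63], [(6, [(12, 11, [3, 4, 5, 0, 2, 1]), (33, 25, [0, 1, 2,
     3, 5, 4]), (41, 17, [0, 1, 2, 3, 4, 5])]), (11, [(32, 17, [3, 5, 4, 0, 1, 2]), (33, 16, [3,
     4, 5, 0, 1, 2]), (59, 13, [0, 2, 1, 3, 4, 5]), (61, 11, [0, 1, 2, 3, 4, 5])]), (17, [(11, 4,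
     [0, 2, 3, 4, 1, 5]), (32, 25, [3, 5, 0, 1, 4, 2]), (41, 16, [3, 4, 0, 1, 5, 2])]), (21, [(32,
     31, [3, 5, 1, 0, 4, 2]), (47, 16, [3, 4, 1, 0, 5, 2]), (59, 4, [0, 2, 4, 3, 1, 5])])]),
    ([[1, 0, 0, 0, 0, - 6], [0, 1, 0, 0, 0, - 5], [0, 0, 1, 0, 0, - 4], [0, 0, 0, 1, 0, - 3], [0,
     0, 0, 0, 1, 2]], [0, 1, 2, 3, 4, 5, 6, 7, 8, 10, 11, 12, 13, 14, 15, 20, 24, 31, 47, 48, 63],
     [(3, [(48, 47, [0, 1, 2, 3, 4, 5])])]),
    ([[1, 0, 0, - 2, 0, - 2], [0, 1, 0, - 1, 0, - 2], [0, 0, 1, - 1, 0, - 1], [0, 0, 0, 0, 1, 2]],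
     [0, 1, 2, 3, 4, 5, 6, 7, 8, 9, 11, 12, 13, 15, 17, 20, 21, 27, 32, 48, 63], [(22, [(20, 7,
     [2, 3, 5, 4, 0, 1])]), (23, [(17, 7, [0, 3, 4, 2, 5, 1])])]),
    ([[1, 0, 0, 0, 0, - 3], [0, 1, 0, 0, 0, 2], [0, 0, 1, 0, 1, - 5], [0, 0, 0, 1, 1, - 4], [0, 0,
     0, 0, 2, - 6]], [0, 1, 3, 4, 5, 6, 7, 8, 9, 13, 15, 17, 20, 21, 25, 26, 29, 31, 34, 53, 63],
     [(5, [(53, 34, [1, 0, 4, 2, 5, 3])])])]"

definition steps2 :: "step list" where
  "steps2 = [
    ([[1, 0, 0, 0, 0, - 5], [0, 1, 0, 0, 0, 3], [0, 0, 1, 0, 0, 4], [0, 0, 0, 1, 1, 4], [0, 0, 0,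
     0, 2, 2]], [2, 3, 4, 5, 6, 7, 8, 9, 10, 11, 12, 13, 15, 18, 19, 21, 31, 35, 39, 41, 63], []),
    ([[1, 0, 0, 0, 0, - 3], [0, 1, 0, 0, 0, 2], [0, 0, 1, 0, 1, 5], [0, 0, 0, 1, 1, 6], [0, 0, 0,
     0, 2, 4]], [0, 2, 3, 4, 5, 6, 7, 8, 9, 10, 12, 13, 15, 17, 20, 25, 31, 34, 35, 49, 63], [(5,
     [(49, 31, [1, 0, 4, 2, 5, 3])])]),
    ([[1, 0, 0, - 2, 0, 1], [0, 1, 0, 1, 0, - 1], [0, 0, 1, 1, 1, - 1], [0, 0, 0, 0, 2, - 2]], [0,
     2, 3, 4, 5, 7, 10, 11, 14, 15, 16, 17, 18, 19, 26, 27, 30, 31, 42, 43, 63], [(25, [(18, 11,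
     [4, 2, 3, 0, 5, 1])]), (26, [(27, 4, [0, 5, 1, 4, 2, 3])]), (27, [(30, 5, [2, 4, 3, 0, 5,
     1])])]),
    ([[1, 0, 0, 0, - 4, 3], [0, 1, 0, 0, - 2, 1], [0, 0, 1, 0, 2, - 2], [0, 0, 0, 1, 3, - 2]], [0,
     2, 4, 6, 7, 10, 11, 14, 15, 18, 20, 22, 23, 30, 31, 38, 39, 50, 52, 54, 63], [(22, [(23, 14,
     [3, 0, 4, 5, 1, 2])])]),
    ([[1, 0, - 1, 0, 0, 1], [0, 1, - 1, 0, 0, 2], [0, 0, 0, 1, 0, 2], [0, 0, 0, 0, 1, 3], [0, 0,
     0, 0, 0, 6]], [3, 4, 5, 6, 7, 8, 9, 10, 11, 14, 15, 16, 18, 19, 23, 24, 31, 40, 47, 56, 63],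
     []),
    ([[1, 0, - 1, 0, 0, 1], [0, 1, - 1, 0, 0, 2], [0, 0, 0, 1, 1, 2], [0, 0, 0, 0, 2, 0], [0, 0,
     0, 0, 0, 3]], [3, 4, 5, 6, 7, 8, 9, 10, 11, 12, 13, 14, 15, 16, 23, 24, 31, 40, 47, 56, 63],
     []),
    ([[1, 0, - 1, 0, - 2, 0], [0, 1, - 1, 0, - 1, 0], [0, 0, 0, 1, - 1, 1], [0, 0, 0, 0, 0, 2]],
     [0, 1, 3, 8, 9, 10, 11, 12, 13, 16, 17, 19, 24, 25, 27, 31, 32, 56, 57, 59, 63], [(30, [(57,
     12, [1, 2, 0, 3, 5, 4])]), (31, [(25, 12, [0, 1, 2, 3, 5, 4])])]),
    ([[1, 0, 0, - 1, 0, - 1], [0, 1, 0, - 1, 1, 0], [0, 0, 1, 1, 0, - 1], [0, 0, 0, 0, 2, 3]], [0,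
     1, 2, 3, 5, 7, 8, 9, 10, 12, 13, 14, 15, 17, 21, 28, 29, 31, 45, 53, 63], [(22, [(17, 7, [0,
     3, 5, 4, 1, 2]), (28, 15, [4, 0, 1, 5, 2, 3])]), (24, [(17, 15, [0, 3, 4, 5, 2, 1])])]),
    ([[1, 0, - 1, 0, - 2, - 2], [0, 1, - 1, 0, - 1, - 1], [0, 0, 0, 1, - 1, - 1]], [0, 1, 2, 3, 5,
     8, 9, 11, 15, 17, 18, 19, 21, 31, 32, 33, 34, 35, 37, 47, 63], [(22, [(32, 17, [1, 2, 3, 5,
     0, 4]), (33, 21, [0, 1, 3, 5, 2, 4]), (35, 18, [1, 2, 3, 4, 0, 5]), (37, 17, [0, 1, 3, 4, 2,
     5])]), (24, [(32, 18, [0, 3, 5, 1, 2, 4]), (35, 17, [0, 3, 4, 1, 2, 5])]), (28, [(32, 19, [2,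
     3, 4, 1, 5, 0]), (47, 18, [2, 3, 5, 1, 4, 0])]), (29, [(32, 21, [2, 1, 3, 4, 5, 0]), (47, 17,
     [2, 1, 3, 5, 4, 0])]), (32, [(33, 18, [0, 1, 2, 4, 3, 5]), (34, 17, [0, 1, 2, 5, 3, 4])]),
     (33, [(32, 31, [0, 5, 2, 3, 4, 1])])]),
    ([[1, 0, 0, 0, - 1, 1], [0, 1, 0, 1, - 3, 0], [0, 0, 1, 1, - 1, 0], [0, 0, 0, 2, - 3, 1], [0,
     0, 0, 0, 0, 2]], [1, 2, 3, 5, 7, 8, 9, 10, 11, 12, 13, 15, 20, 25, 26, 27, 29, 31, 32, 59,
     63], []),
    ([[1, 0, - 1, 0, - 1, 0], [0, 1, - 1, 0, - 1, 1], [0, 0, 0, 1, - 1, 1], [0, 0, 0, 0, 0, 2]],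
     [0, 1, 2, 3, 4, 5, 6, 8, 9, 10, 11, 14, 15, 16, 19, 23, 31, 32, 36, 39, 63], [(0, [(8, 6, [0,
     1, 4, 3, 2, 5])]), (1, [(8, 5, [0, 1, 4, 3, 2, 5])]), (35, [(39, 8, [1, 3, 2, 4, 0, 5]), (39,
     16, [0, 4, 2, 3, 1, 5])])]),
    ([[1, 0, 0, 0, 0, - 3], [0, 1, 0, 0, 0, - 2], [0, 0, 1, 0, 1, - 4], [0, 0, 0, 1, 1, - 2], [0,
     0, 0, 0, 2, - 5]], [0, 1, 2, 3, 4, 5, 6, 7, 9, 12, 13, 15, 17, 19, 21, 23, 31, 40, 53, 55,
     63], []),
    ([[1, 0, 0, - 1, 0, - 3], [0, 1, 0, - 1, 0, - 2], [0, 0, 1, - 1, 0, - 1], [0, 0, 0, 0, 1, 2]],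
     [0, 1, 2, 3, 4, 5, 6, 7, 8, 10, 11, 12, 13, 14, 15, 20, 26, 29, 32, 48, 63], [(1, [(12, 3,
     [0, 2, 1, 3, 5, 4])]), (22, [(20, 7, [2, 3, 5, 4, 0, 1]), (26, 3, [0, 3, 4, 1, 2, 5])]), (34,
     [(26, 1, [0, 1, 2, 5, 3, 4])]), (37, [(20, 3, [3, 1, 0, 5, 2, 4])])]),
    ([[1, 0, - 1, 0, - 1, 0], [0, 1, - 1, 0, 0, 1], [0, 0, 0, 1, 1, 2], [0, 0, 0, 0, 0, 3]], [0,
     1, 2, 3, 4, 5, 6, 7, 9, 11, 13, 18, 19, 21, 24, 25, 29, 31, 53, 56, 63], [(34, [(19, 13, [1,
     0, 2, 4, 3, 5])]), (36, [(19, 6, [0, 2, 1, 5, 3, 4])])]),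
    ([[1, 0, 0, 0, 0, 3], [0, 1, 0, 0, 0, 4], [0, 0, 1, 0, 1, - 5], [0, 0, 0, 1, 1, - 1], [0, 0,
     0, 0, 2, - 8]], [0, 1, 2, 4, 5, 6, 7, 10, 12, 13, 14, 18, 21, 22, 28, 29, 31, 44, 53, 60,
     63], [(5, [(60, 10, [1, 2, 5, 4, 3, 0])])]),
    ([[1, 0, - 1, 0, 0, - 3], [0, 1, 1, 0, 0, 2], [0, 0, 0, 1, 0, 3], [0, 0, 0, 0, 1, 4]], [0, 1,
     3, 4, 6, 7, 8, 12, 13, 14, 15, 16, 17, 20, 21, 33, 35, 38, 39, 45, 63], [(36, [(45, 14, [2,
     3, 4, 5, 1, 0])]), (40, [(21, 3, [1, 4, 5, 3, 0, 2])])]),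
    ([[1, 0, - 1, 0, 0, - 3], [0, 1, 1, 0, 0, - 1], [0, 0, 0, 1, 0, - 3], [0, 0, 0, 0, 1, - 2]],
     [0, 2, 3, 6, 8, 9, 10, 11, 15, 16, 18, 19, 24, 25, 27, 31, 34, 42, 43, 59, 63], [(38, [(42,
     9, [1, 4, 0, 3, 5, 2])])]),
    ([[1, 0, - 1, 0, - 1, 0], [0, 1, 1, 0, - 1, 1], [0, 0, 0, 1, - 1, 1], [0, 0, 0, 0, 0, 2]], [0,
     1, 3, 4, 6, 7, 12, 13, 14, 15, 16, 17, 19, 21, 23, 29, 31, 32, 36, 61, 63], [(0, [(13, 3, [0,
     1, 4, 3, 2, 5])]), (2, [(19, 13, [3, 1, 0, 4, 5, 2])])]),
    ([[1, 0, - 1, 0, 0, - 1], [0, 1, 1, 0, 0, - 3], [0, 0, 0, 1, 0, - 3], [0, 0, 0, 0, 1, 2]], [0,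
     1, 2, 3, 6, 7, 11, 12, 14, 15, 19, 22, 23, 26, 27, 31, 43, 48, 50, 58, 63], [(34, [(58, 1,
     [0, 2, 1, 5, 3, 4])]), (39, [(48, 43, [0, 4, 5, 1, 2, 3])])]),
    ([[1, 0, - 1, 0, - 2, - 1], [0, 1, - 1, 0, - 1, - 1], [0, 0, 0, 1, - 1, - 1]], [0, 1, 2, 3, 5,
     8, 9, 10, 11, 15, 16, 17, 19, 20, 24, 27, 31, 35, 57, 59, 63], [(34, [(27, 5, [1, 2, 0, 3, 4,
     5]), (35, 17, [0, 4, 5, 1, 2, 3])]), (36, [(17, 2, [0, 1, 2, 3, 5, 4])]), (38, [(8, 5, [5, 1,
     3, 0, 4, 2])]), (39, [(57, 20, [0, 2, 1, 5, 4, 3])]), (41, [(59, 20, [4, 5, 0, 1, 2, 3])]),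
     (42, [(57, 5, [0, 5, 4, 1, 2, 3])]), (43, [(24, 5, [0, 5, 4, 3, 1, 2])]), (44, [(24, 15, [0,
     5, 4, 3, 2, 1])])])]"

definition steps3 :: "step list" where
  "steps3 = [
    ([[1, 0, - 1, 0, 0, 1], [0, 1, - 1, 0, 0, 4], [0, 0, 0, 1, 0, 2], [0, 0, 0, 0, 1, 3], [0, 0,
     0, 0, 0, 6]], [3, 4, 5, 6, 7, 8, 9, 12, 13, 14, 15, 16, 19, 23, 24, 28, 31, 40, 47, 56, 63],
     []),
    ([[1, 0, - 1, 0, - 1, 0], [0, 1, - 1, 0, 0, 1], [0, 0, 0, 1, - 1, 1], [0, 0, 0, 0, 0, 2]], [0,
     1, 2, 3, 4, 5, 8, 9, 11, 12, 13, 15, 16, 17, 23, 27, 29, 31, 32, 57, 63], [(2, [(57, 3, [2,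
     4, 0, 1, 5, 3]), (57, 5, [1, 3, 0, 2, 5, 4]), (57, 15, [3, 1, 0, 4, 5, 2]), (57, 23, [4, 2,
     0, 3, 5, 1])]), (46, [(57, 2, [2, 1, 0, 3, 5, 4]), (57, 4, [1, 2, 0, 4, 5, 3])])]),
    ([[1, 0, - 1, 0, 0, - 1], [0, 1, 1, 0, 0, 3], [0, 0, 0, 1, 0, 2], [0, 0, 0, 0, 1, 3]], [0, 1,
     3, 4, 6, 7, 9, 11, 13, 14, 15, 20, 21, 22, 23, 27, 29, 31, 35, 61, 63], [(34, [(22, 13, [4,
     2, 3, 1, 0, 5])]), (45, [(27, 13, [0, 3, 5, 4, 1, 2])])]),
    ([[1, 0, 0, 0, 0, - 2], [0, 1, 0, 0, 1, - 8], [0, 0, 1, 0, 1, - 3], [0, 0, 0, 1, 1, - 2], [0,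
     0, 0, 0, 2, - 9]], [0, 1, 2, 3, 5, 7, 9, 10, 11, 15, 16, 17, 18, 21, 23, 27, 29, 31, 50, 55,
     63], []),
    ([[1, 0, 0, - 1, 0, - 1], [0, 1, 0, 1, 0, - 2], [0, 0, 1, 1, 0, - 1], [0, 0, 0, 0, 1, - 2]],
     [0, 1, 2, 3, 5, 7, 8, 11, 12, 13, 14, 15, 19, 23, 27, 29, 30, 31, 55, 59, 63], [(49, [(55, 8,
     [4, 3, 1, 2, 0, 5])])]),
    ([[1, 0, - 1, 0, - 1, - 1], [0, 1, - 1, 0, - 1, 0], [0, 0, 0, 1, - 1, - 1]], [0, 1, 2, 3, 8,
     9, 10, 11, 13, 15, 16, 18, 19, 24, 25, 26, 27, 31, 43, 59, 63], [(45, [(18, 9, [0, 1, 2, 4,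
     5, 3]), (18, 13, [1, 4, 5, 0, 2, 3]), (24, 3, [0, 3, 5, 4, 2, 1]), (24, 13, [3, 4, 2, 0, 5,
     1])]), (47, [(26, 1, [0, 1, 2, 5, 3, 4])]), (48, [(24, 15, [1, 5, 4, 0, 3, 2]), (43, 18, [3,
     2, 4, 0, 1, 5])]), (50, [(26, 13, [1, 3, 5, 2, 0, 4])])]),
    ([[0, 1, 0, - 1, 0, - 2], [0, 0, 1, - 1, 0, - 1], [0, 0, 0, 0, 1, 2]], [0, 2, 3, 4, 5, 6, 7,
     8, 9, 10, 11, 12, 13, 15, 20, 21, 26, 27, 31, 48, 63], [(22, [(20, 7, [2, 3, 5, 4, 0, 1]),
     (21, 6, [1, 0, 4, 2, 3, 5]), (26, 3, [0, 3, 4, 1, 2, 5])]), (34, [(21, 2, [1, 2, 3, 5, 0,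
     4])]), (45, [(9, 6, [3, 1, 5, 2, 4, 0]), (12, 3, [0, 2, 5, 3, 4, 1]), (20, 3, [2, 3, 1, 4, 5,
     0])])]),
    ([[1, 0, 0, - 2, 1, - 1], [0, 1, 0, 1, 1, - 2], [0, 0, 1, 1, 1, - 1], [0, 0, 0, 0, 2, - 3]],
     [0, 2, 3, 10, 14, 15, 16, 17, 19, 20, 21, 23, 26, 27, 29, 30, 31, 48, 49, 51, 63], [(45,
     [(27, 14, [3, 1, 5, 2, 0, 4])])]),
    ([[1, 0, 0, - 2, 0, - 2], [0, 1, 0, - 1, 0, - 2], [0, 0, 1, 2, 0, 1], [0, 0, 0, 0, 1, 3]], [0,
     1, 2, 5, 8, 9, 12, 13, 15, 17, 18, 19, 21, 22, 29, 31, 41, 44, 53, 57, 63], [(34, [(57, 44,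
     [5, 2, 4, 0, 1, 3])])]),
    ([[1, 0, - 2, 0, - 1, 2], [0, 1, 1, 0, 1, - 1], [0, 0, 0, 1, 1, - 1]], [0, 1, 3, 4, 5, 6, 7,
     12, 19, 20, 22, 23, 28, 29, 30, 31, 44, 45, 55, 61, 63], [(34, [(20, 7, [2, 5, 3, 4, 0, 1]),
     (30, 1, [0, 5, 4, 3, 1, 2])]), (45, [(30, 5, [0, 5, 4, 3, 1, 2])]), (51, [(22, 5, [5, 0, 4,
     3, 1, 2])]), (53, [(44, 1, [4, 3, 1, 5, 0, 2])]), (54, [(61, 3, [3, 1, 4, 2, 0, 5])])]),
    ([[0, 1, 0, 0, - 3, 2], [0, 0, 1, 0, 2, - 2], [0, 0, 0, 1, 2, - 1]], [0, 4, 5, 6, 7, 14, 15,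
     20, 21, 22, 23, 26, 30, 31, 37, 38, 39, 53, 55, 62, 63], [(22, [(22, 5, [0, 1, 4, 2, 3, 5]),
     (38, 15, [4, 1, 2, 5, 0, 3])]), (34, [(62, 7, [0, 4, 1, 2, 3, 5])]), (45, [(62, 15, [0, 4, 1,
     2, 5, 3])]), (51, [(22, 15, [4, 0, 1, 2, 5, 3])]), (52, [(55, 15, [0, 2, 3, 4, 1, 5])]), (55,
     [(55, 14, [0, 5, 3, 2, 1, 4])])]),
    ([[1, 0, 0, 0, - 5, - 2], [0, 1, 0, 0, - 4, - 2], [0, 0, 1, 0, - 1, - 1], [0, 0, 0, 1, 3, 2]],
     [0, 1, 2, 3, 4, 5, 6, 7, 10, 12, 13, 14, 15, 28, 34, 35, 45, 46, 47, 60, 63], [(22, [(12, 7,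
     [2, 4, 5, 3, 0, 1])]), (45, [(35, 10, [2, 4, 1, 3, 5, 0])])]),
    ([[1, 0, 0, - 2, 0, - 3], [0, 1, 0, - 1, 0, - 3], [0, 0, 1, 2, 0, 5], [0, 0, 0, 0, 1, 2]], [0,
     1, 5, 6, 7, 8, 9, 13, 15, 19, 22, 23, 32, 33, 37, 47, 53, 54, 57, 61, 63], []),
    ([[1, 0, - 2, 0, - 1, 3], [0, 1, 1, 0, 1, - 1], [0, 0, 0, 1, 1, - 1]], [0, 4, 6, 12, 20, 22,
     23, 26, 27, 28, 29, 30, 31, 44, 51, 54, 55, 58, 61, 62, 63], [(22, [(29, 26, [1, 0, 2, 5, 3,
     4])]), (34, [(62, 23, [0, 5, 4, 3, 1, 2])]), (45, [(58, 23, [0, 5, 4, 3, 1, 2]), (62, 27, [0,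
     5, 4, 3, 2, 1])]), (51, [(54, 27, [5, 0, 4, 3, 2, 1]), (54, 29, [5, 0, 4, 3, 1, 2])]), (52,
     [(61, 27, [0, 3, 1, 5, 4, 2])]), (55, [(61, 26, [0, 2, 1, 3, 4, 5])]), (57, [(44, 23, [0, 2,
     5, 1, 3, 4])]), (58, [(58, 29, [3, 1, 4, 2, 5, 0])])]),
    ([[1, 0, - 2, 0, - 1, 0], [0, 1, 1, 0, 0, - 1], [0, 0, 0, 1, - 1, - 1]], [0, 1, 2, 3, 4, 6, 7,
     8, 9, 11, 14, 15, 19, 20, 30, 31, 35, 43, 59, 61, 63], [(22, [(30, 7, [0, 3, 4, 5, 1, 2])]),
     (34, [(14, 1, [0, 3, 4, 5, 1, 2])]), (45, [(19, 6, [3, 5, 1, 2, 4, 0])]), (52, [(30, 1, [0,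
     5, 2, 3, 4, 1])]), (59, [(59, 4, [0, 1, 2, 5, 4, 3]), (61, 2, [0, 2, 1, 5, 4, 3])])]),
    ([[0, 1, - 1, 0, - 1, - 1], [0, 0, 0, 1, - 1, - 1]], [0, 2, 3, 4, 8, 10, 11, 14, 15, 16, 18,
     19, 30, 31, 32, 34, 35, 46, 47, 62, 63], [(22, [(34, 19, [1, 2, 3, 5, 0, 4]), (35, 18, [1, 2,
     3, 4, 0, 5])]), (34, [(62, 3, [0, 1, 2, 3, 4, 5])]), (45, [(30, 3, [0, 1, 2, 3, 4, 5]), (46,
     3, [0, 1, 2, 3, 5, 4])]), (51, [(19, 14, [1, 0, 2, 3, 5, 4]), (30, 11, [1, 0, 2, 3, 4, 5])]),
     (52, [(32, 18, [0, 3, 5, 1, 2, 4]), (34, 16, [0, 3, 4, 1, 2, 5])]), (55, [(32, 19, [0, 4, 5,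
     3, 2, 1]), (35, 16, [0, 5, 4, 3, 2, 1])]), (56, [(32, 30, [0, 2, 3, 4, 1, 5]), (46, 16, [0,
     2, 3, 5, 1, 4])]), (59, [(32, 31, [0, 4, 5, 3, 2, 1]), (47, 16, [0, 5, 4, 3, 2, 1])]), (60,
     [(35, 30, [0, 5, 4, 1, 2, 3]), (46, 19, [0, 4, 5, 1, 2, 3])])]),
    ([[1, 0, 0, - 2, 0, - 2], [0, 1, 0, - 1, 1, 1], [0, 0, 1, 2, 0, 1], [0, 0, 0, 0, 2, 2]], [0,
     1, 2, 3, 6, 7, 8, 9, 10, 12, 13, 14, 15, 18, 19, 21, 24, 25, 31, 62, 63], [(61, [(18, 1, [2,
     3, 5, 0, 1, 4]), (24, 1, [1, 5, 2, 0, 3, 4])])]),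
    ([[1, - 1, 0, 0, 1, 1], [0, 0, 1, 1, 0, - 1], [0, 0, 0, 0, 2, 2]], [0, 1, 2, 3, 4, 5, 6, 7,
     13, 14, 16, 17, 18, 20, 21, 22, 28, 31, 52, 55, 63], [(61, [(4, 3, [4, 5, 3, 2, 0, 1]), (17,
     4, [1, 5, 3, 2, 0, 4]), (18, 4, [0, 5, 3, 2, 1, 4])]), (62, [(16, 7, [3, 0, 2, 1, 4, 5])])]),
    ([[1, 0, - 1, 0, 0, - 4], [0, 1, - 1, 0, 0, - 2], [0, 0, 0, 1, 0, - 3], [0, 0, 0, 0, 1, 2]],
     [0, 1, 2, 3, 4, 5, 6, 7, 10, 12, 13, 14, 16, 24, 28, 30, 31, 48, 52, 56, 63], [(61, [(52, 10,
     [0, 2, 1, 4, 3, 5])])]),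
    ([[1, 0, 0, - 1, 0, - 3], [0, 1, 0, - 1, 1, 1], [0, 0, 1, 1, 0, 2], [0, 0, 0, 0, 2, 3]], [0,
     2, 6, 7, 8, 10, 12, 13, 14, 15, 18, 19, 21, 29, 31, 44, 45, 47, 60, 62, 63], [(22, [(62, 45,
     [3, 0, 5, 4, 1, 2])])])]"

text \<open>The final entry, with no relations, can be followed by hand. Its 21 sums are the empty
  one, the total, five of the six sums of five elements and fourteen of the fifteen sums of four.
  After passing to complements, the coincidences not excluded by \<open>base\<close> say that one
  element is the sum of two others (lattice 81) or that two disjoint pairs have equal sums (lattice
  85).\<close>

definition steps4 :: "step list" where
  "steps4 = [
    ([[1, 0, 0, - 1, 0, - 1], [0, 1, 0, - 1, 2, 2], [0, 0, 1, 1, 2, 4], [0, 0, 0, 0, 3, 4]], [1,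
     2, 5, 6, 7, 8, 9, 10, 12, 13, 14, 15, 21, 23, 24, 25, 26, 29, 38, 54, 63], []),
    ([[1, 0, - 2, 0, - 2, - 1], [0, 1, - 1, 0, - 1, 0], [0, 0, 0, 1, - 1, - 1]], [0, 1, 2, 3, 4,
     8, 9, 10, 11, 12, 13, 15, 16, 17, 32, 33, 42, 43, 47, 59, 63], [(22, [(42, 3, [0, 3, 5, 1, 2,
     4])]), (61, [(8, 3, [1, 3, 4, 5, 0, 2]), (32, 3, [2, 3, 4, 5, 0, 1]), (33, 16, [3, 1, 2, 4,
     0, 5])]), (64, [(32, 17, [0, 5, 3, 2, 4, 1])]), (65, [(59, 4, [5, 2, 4, 0, 1, 3])]), (66,
     [(47, 16, [1, 0, 5, 4, 3, 2])])]),
    ([[1, - 1, 0, 0, - 1, 1], [0, 0, 1, 0, 2, 0], [0, 0, 0, 1, 2, 1], [0, 0, 0, 0, 0, 2]], [4, 5,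
     6, 7, 8, 9, 10, 11, 13, 16, 18, 20, 21, 23, 24, 27, 30, 31, 32, 48, 63], []),
    ([[1, - 1, 0, 0, - 1, - 1], [0, 0, 1, 0, - 2, - 2], [0, 0, 0, 1, 1, 2]], [0, 1, 4, 5, 6, 12,
     13, 14, 15, 20, 21, 22, 23, 25, 29, 30, 31, 44, 56, 60, 63], [(61, [(20, 1, [0, 4, 3, 2, 1,
     5]), (20, 15, [5, 4, 3, 2, 0, 1]), (25, 20, [4, 1, 5, 2, 0, 3])]), (63, [(44, 31, [0, 5, 2,
     3, 1, 4])]), (67, [(25, 4, [0, 5, 1, 4, 3, 2])]), (68, [(25, 5, [1, 0, 2, 4, 5, 3])])]),
    ([[1, - 1, 0, - 1, 0, - 1], [0, 0, 1, - 1, 0, - 2], [0, 0, 0, 0, 1, 2]], [0, 1, 4, 5, 6, 8, 9,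
     10, 11, 13, 14, 15, 17, 30, 32, 40, 43, 48, 59, 61, 63], [(61, [(43, 13, [0, 1, 5, 3, 2,
     4])]), (67, [(17, 4, [0, 5, 1, 3, 4, 2]), (59, 13, [0, 1, 5, 3, 2, 4])]), (69, [(17, 13, [0,
     1, 4, 2, 3, 5]), (59, 4, [0, 5, 2, 4, 3, 1])])]),
    ([[1, - 1, - 1, 0, - 1, - 1], [0, 0, 0, 1, - 1, - 1]], [0, 1, 8, 9, 10, 11, 12, 13, 15, 16,
     17, 18, 19, 20, 22, 25, 26, 27, 29, 31, 63], [(22, [(12, 11, [2, 0, 1, 3, 4, 5]), (13, 10,
     [1, 0, 2, 3, 4, 5])]), (61, [(19, 8, [2, 3, 4, 5, 0, 1]), (22, 8, [0, 3, 4, 5, 1, 2]), (25,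
     15, [0, 3, 5, 4, 1, 2]), (26, 15, [1, 3, 5, 4, 0, 2]), (26, 20, [0, 2, 1, 3, 4, 5]), (29, 19,
     [0, 1, 2, 3, 4, 5])]), (63, [(27, 20, [0, 2, 4, 5, 1, 3]), (29, 18, [0, 1, 4, 5, 2, 3])]),
     (67, [(18, 12, [0, 1, 2, 3, 5, 4]), (20, 10, [0, 2, 1, 3, 5, 4]), (26, 12, [0, 2, 1, 3, 4,
     5]), (29, 11, [0, 1, 2, 3, 4, 5])]), (69, [(18, 13, [0, 1, 4, 5, 3, 2]), (20, 11, [0, 2, 4,
     5, 3, 1]), (27, 12, [0, 2, 5, 4, 3, 1]), (29, 10, [0, 1, 5, 4, 3, 2])]), (70, [(19, 12, [0,
     2, 5, 3, 4, 1]), (26, 13, [0, 1, 4, 3, 5, 2])])]),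
    ([[1, - 1, 0, 0, - 2, - 1], [0, 0, 1, 0, - 3, - 1], [0, 0, 0, 1, 2, 1]], [0, 1, 2, 3, 4, 5, 6,
     7, 12, 14, 15, 22, 31, 38, 44, 46, 47, 54, 55, 60, 63], [(22, [(44, 15, [4, 2, 3, 5, 0,
     1])]), (61, [(4, 3, [5, 4, 3, 2, 0, 1]), (38, 31, [0, 5, 1, 4, 2, 3]), (44, 22, [1, 5, 0, 4,
     2, 3]), (47, 22, [1, 4, 3, 2, 0, 5])]), (71, [(44, 31, [5, 0, 1, 4, 2, 3])])]),
    ([[1, 0, - 2, 0, - 3, - 2], [0, 1, - 1, 0, - 1, 0], [0, 0, 0, 1, - 1, - 1]], [0, 1, 2, 3, 4,
     5, 8, 9, 10, 11, 12, 13, 14, 15, 32, 33, 42, 43, 46, 47, 63], [(61, [(8, 3, [1, 3, 4, 5, 0,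
     2]), (9, 2, [2, 1, 0, 3, 4, 5]), (9, 4, [1, 2, 0, 3, 4, 5]), (32, 3, [2, 3, 4, 5, 0, 1])]),
     (72, [(8, 5, [0, 3, 4, 2, 1, 5]), (33, 2, [0, 1, 4, 5, 3, 2])])]),
    ([[0, 1, - 1, 0, - 1, 0], [0, 0, 0, 1, - 1, - 1]], [0, 1, 2, 3, 4, 8, 9, 10, 11, 12, 13, 14,
     15, 31, 32, 42, 43, 47, 59, 62, 63], [(22, [(14, 9, [0, 1, 2, 3, 4, 5]), (42, 3, [0, 3, 5, 1,
     2, 4])]), (61, [(8, 3, [1, 3, 4, 5, 0, 2]), (9, 2, [2, 1, 0, 3, 4, 5]), (9, 4, [1, 2, 0, 3,
     4, 5]), (10, 1, [2, 0, 1, 3, 4, 5]), (12, 1, [1, 0, 2, 3, 4, 5]), (32, 3, [2, 3, 4, 5, 0,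
     1])]), (71, [(14, 1, [0, 1, 2, 3, 4, 5]), (42, 1, [0, 3, 5, 1, 2, 4])]), (72, [(32, 31, [5,
     3, 2, 4, 1, 0]), (59, 4, [2, 1, 5, 4, 3, 0])]), (73, [(62, 1, [0, 1, 2, 3, 4, 5])])]),
    ([[1, - 1, 0, - 1, 0, 0], [0, 0, 1, 1, 1, - 1], [0, 0, 0, 0, 2, - 2]], [0, 1, 12, 13, 16, 17,
     18, 19, 21, 24, 28, 29, 31, 40, 43, 49, 50, 51, 53, 61, 63], [(61, [(50, 1, [2, 0, 1, 3, 4,
     5]), (50, 43, [1, 4, 3, 0, 2, 5]), (53, 43, [1, 5, 3, 0, 2, 4])]), (71, [(24, 19, [4, 2, 5,
     3, 0, 1]), (43, 16, [4, 3, 5, 2, 0, 1])])]),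
    ([[1, - 1, 0, - 1, 0, - 1], [0, 0, 1, 1, 0, 2], [0, 0, 0, 0, 1, 2]], [0, 1, 2, 4, 5, 6, 7, 10,
     13, 14, 15, 21, 32, 34, 36, 38, 44, 47, 54, 55, 63], [(61, [(6, 1, [4, 0, 1, 2, 3, 5]), (13,
     6, [4, 1, 0, 3, 2, 5])]), (71, [(38, 13, [1, 0, 5, 2, 3, 4]), (54, 1, [0, 1, 5, 3, 2, 4])])]),
    ([[1, - 1, 0, 0, - 1, - 1], [0, 0, 1, 0, 2, 2], [0, 0, 0, 1, 2, 3]], [0, 1, 2, 4, 5, 6, 7, 9,
     10, 11, 13, 21, 23, 33, 34, 37, 45, 48, 52, 55, 63], [(61, [(11, 4, [4, 2, 3, 5, 0, 1]), (37,
     23, [0, 2, 3, 5, 1, 4]), (45, 23, [3, 0, 5, 2, 1, 4])]), (71, [(33, 13, [0, 1, 4, 5, 2, 3]),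
     (34, 21, [1, 0, 4, 3, 2, 5])]), (76, [(48, 7, [0, 4, 3, 5, 2, 1])])]),
    ([[1, - 1, - 1, 0, - 1, 0], [0, 0, 0, 1, - 1, - 1]], [0, 1, 8, 9, 10, 11, 12, 13, 14, 15, 32,
     34, 36, 41, 43, 45, 46, 47, 59, 61, 63], [(22, [(12, 11, [2, 0, 1, 3, 4, 5]), (13, 10, [1, 0,
     2, 3, 4, 5])]), (61, [(34, 1, [3, 0, 1, 5, 2, 4]), (36, 1, [3, 0, 2, 5, 1, 4]), (59, 13, [0,
     2, 1, 3, 4, 5]), (61, 11, [0, 1, 2, 3, 4, 5])]), (71, [(43, 36, [2, 0, 1, 3, 4, 5]), (45, 34,
     [1, 0, 2, 3, 4, 5]), (46, 1, [0, 1, 2, 4, 3, 5])]), (74, [(34, 9, [2, 1, 0, 3, 4, 5]), (34,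
     12, [0, 1, 2, 3, 4, 5]), (36, 9, [1, 2, 0, 3, 4, 5]), (36, 10, [0, 2, 1, 3, 4, 5]), (43, 13,
     [0, 2, 1, 3, 5, 4]), (45, 11, [0, 1, 2, 3, 5, 4])]), (75, [(34, 13, [3, 5, 2, 4, 0, 1]), (36,
     11, [3, 5, 1, 4, 0, 2])]), (76, [(43, 12, [0, 2, 5, 4, 3, 1]), (45, 10, [0, 1, 5, 4, 3,
     2])]), (77, [(59, 36, [0, 2, 3, 5, 1, 4]), (61, 34, [0, 1, 3, 5, 2, 4])])]),
    ([[1, - 1, 0, 1, - 2, - 1], [0, 0, 1, 1, - 1, 0], [0, 0, 0, 2, - 4, - 2]], [0, 1, 2, 4, 5, 6,
     9, 10, 12, 13, 14, 36, 37, 38, 44, 45, 46, 47, 52, 55, 63], [(61, [(37, 12, [1, 4, 2, 3, 0,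
     5]), (38, 12, [0, 4, 2, 3, 1, 5]), (52, 47, [5, 4, 3, 2, 0, 1])]), (71, [(37, 9, [0, 1, 4, 3,
     2, 5]), (45, 6, [0, 1, 5, 3, 2, 4])]), (74, [(44, 5, [1, 0, 5, 4, 3, 2]), (44, 6, [0, 1, 5,
     4, 3, 2])])]),
    ([[1, - 1, - 1, 0, - 2, - 1], [0, 0, 0, 1, - 1, - 1]], [0, 1, 8, 9, 10, 12, 13, 14, 15, 32,
     33, 34, 36, 41, 43, 45, 46, 47, 59, 61, 63], [(22, [(13, 10, [1, 0, 2, 3, 4, 5])]), (61,
     [(41, 15, [0, 3, 4, 5, 1, 2]), (41, 34, [2, 1, 0, 3, 4, 5]), (41, 36, [1, 2, 0, 3, 4, 5]),
     (59, 13, [0, 2, 1, 3, 4, 5])]), (71, [(43, 36, [2, 0, 1, 3, 4, 5]), (45, 34, [1, 0, 2, 3, 4,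
     5]), (46, 9, [0, 1, 2, 5, 3, 4])]), (74, [(34, 1, [2, 0, 1, 3, 5, 4]), (34, 9, [2, 1, 0, 3,
     4, 5]), (34, 12, [0, 1, 2, 3, 4, 5]), (36, 1, [1, 0, 2, 3, 5, 4]), (36, 9, [1, 2, 0, 3, 4,
     5]), (36, 10, [0, 2, 1, 3, 4, 5]), (43, 13, [0, 2, 1, 3, 5, 4])]), (78, [(34, 13, [1, 0, 2,
     3, 4, 5]), (43, 12, [2, 0, 1, 3, 5, 4]), (45, 10, [1, 0, 2, 3, 5, 4])]), (79, [(59, 36, [0,
     2, 4, 5, 3, 1]), (61, 34, [0, 1, 4, 5, 3, 2])])]),
    ([[0, 0, 0, 1, - 1, - 1]], [0, 2, 4, 8, 9, 10, 11, 12, 13, 14, 15, 32, 33, 34, 36, 43, 45, 46,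
     47, 62, 63], [(22, [(12, 11, [2, 0, 1, 3, 4, 5]), (13, 10, [1, 0, 2, 3, 4, 5]), (14, 9, [0,
     1, 2, 3, 4, 5])]), (61, [(9, 2, [2, 1, 0, 3, 4, 5]), (9, 4, [1, 2, 0, 3, 4, 5]), (10, 4, [0,
     2, 1, 3, 4, 5]), (12, 2, [0, 1, 2, 3, 4, 5]), (62, 11, [1, 0, 2, 3, 4, 5]), (62, 13, [2, 0,
     1, 3, 4, 5])]), (71, [(11, 4, [2, 0, 1, 3, 4, 5]), (13, 2, [1, 0, 2, 3, 4, 5]), (46, 33, [0,
     1, 2, 3, 4, 5])]), (74, [(33, 2, [2, 1, 0, 3, 5, 4]), (33, 4, [1, 2, 0, 3, 5, 4]), (33, 10,
     [2, 0, 1, 3, 4, 5]), (33, 12, [1, 0, 2, 3, 4, 5]), (34, 4, [0, 2, 1, 3, 5, 4]), (34, 9, [2,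
     1, 0, 3, 4, 5]), (34, 12, [0, 1, 2, 3, 4, 5]), (36, 2, [0, 1, 2, 3, 5, 4]), (36, 9, [1, 2, 0,
     3, 4, 5]), (36, 10, [0, 2, 1, 3, 4, 5]), (46, 11, [1, 0, 2, 3, 5, 4]), (46, 13, [2, 0, 1, 3,
     5, 4])]), (78, [(33, 14, [0, 1, 2, 3, 4, 5]), (34, 13, [1, 0, 2, 3, 4, 5]), (36, 11, [2, 0,
     1, 3, 4, 5]), (43, 12, [2, 0, 1, 3, 5, 4]), (45, 10, [1, 0, 2, 3, 5, 4]), (46, 9, [0, 1, 2,
     3, 5, 4])]), (80, [(43, 4, [2, 0, 1, 3, 5, 4]), (45, 2, [1, 0, 2, 3, 5, 4]), (62, 33, [0, 1,
     2, 3, 4, 5])])]),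
    ([[0, 0, 1, - 1, - 1, 1], [0, 0, 0, 0, 0, 2]], [0, 1, 4, 5, 7, 16, 17, 21, 23, 24, 25, 27, 31,
     32, 33, 48, 49, 53, 55, 61, 63], [(81, [(17, 4, [1, 2, 4, 0, 3, 5]), (24, 1, [1, 2, 5, 0, 3,
     4]), (27, 21, [0, 2, 3, 1, 4, 5]), (33, 16, [1, 2, 3, 0, 4, 5]), (61, 23, [0, 2, 4, 1, 3,
     5]), (61, 27, [0, 2, 5, 1, 3, 4])])]),
    ([[0, 1, - 1, - 1, 0, 1], [0, 0, 0, 0, 1, 2]], [0, 1, 2, 3, 8, 9, 11, 12, 13, 15, 29, 32, 33,
     41, 43, 45, 49, 56, 57, 59, 63], [(81, [(9, 2, [1, 3, 4, 2, 0, 5]), (12, 1, [1, 4, 5, 0, 2,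
     3]), (33, 2, [2, 3, 4, 1, 0, 5]), (33, 8, [1, 2, 4, 3, 0, 5]), (41, 2, [1, 3, 5, 0, 2, 4]),
     (41, 29, [0, 1, 3, 5, 2, 4]), (49, 8, [1, 2, 4, 0, 3, 5]), (49, 12, [2, 3, 5, 1, 0, 4]), (49,
     43, [0, 2, 5, 4, 1, 3]), (49, 45, [0, 1, 5, 4, 2, 3]), (56, 33, [1, 2, 5, 0, 3, 4]), (56, 45,
     [1, 3, 5, 4, 0, 2]), (57, 12, [1, 3, 4, 0, 2, 5]), (59, 45, [0, 1, 2, 5, 3, 4])])]),
    ([[1, - 1, - 1, 0, 0, 1], [0, 0, 0, 1, 1, 2]], [0, 1, 4, 5, 6, 8, 9, 12, 13, 14, 15, 28, 30,
     40, 44, 45, 46, 56, 60, 61, 63], [(81, [(8, 5, [1, 4, 5, 3, 0, 2]), (8, 6, [0, 4, 5, 3, 1,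
     2]), (9, 4, [0, 2, 4, 5, 1, 3]), (13, 6, [0, 1, 4, 5, 2, 3]), (28, 6, [0, 2, 5, 1, 3, 4]),
     (28, 15, [2, 3, 5, 4, 0, 1]), (40, 28, [0, 1, 3, 5, 2, 4]), (44, 30, [0, 2, 3, 5, 1, 4]),
     (45, 28, [0, 3, 5, 4, 1, 2]), (46, 28, [0, 2, 3, 4, 1, 5]), (56, 45, [1, 3, 5, 4, 0, 2])])]),
    ([[0, 0, 1, - 1, - 1, 1]], [0, 1, 5, 9, 16, 17, 24, 25, 27, 29, 31, 32, 33, 45, 47, 53, 55,
     57, 59, 61, 63], [(81, [(16, 5, [1, 2, 4, 5, 0, 3]), (16, 9, [1, 2, 5, 4, 0, 3]), (24, 1, [1,
     2, 5, 0, 3, 4]), (32, 5, [1, 3, 4, 5, 0, 2]), (32, 17, [1, 2, 3, 5, 0, 4]), (33, 16, [1, 2,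
     3, 4, 0, 5]), (45, 31, [0, 2, 3, 5, 1, 4]), (47, 29, [0, 2, 3, 4, 1, 5]), (53, 31, [0, 2, 4,
     5, 1, 3]), (53, 47, [0, 2, 5, 4, 1, 3]), (55, 29, [0, 2, 4, 3, 1, 5]), (55, 45, [0, 2, 5, 3,
     1, 4]), (57, 31, [0, 3, 4, 5, 1, 2]), (59, 29, [0, 3, 4, 2, 1, 5]), (61, 27, [0, 2, 5, 1, 3,
     4])]), (82, [(33, 29, [0, 1, 5, 3, 4, 2]), (45, 17, [0, 1, 4, 2, 5, 3]), (53, 9, [0, 1, 3, 2,
     5, 4]), (57, 5, [0, 1, 2, 3, 4, 5])]), (83, [(32, 29, [1, 5, 3, 4, 0, 2]), (33, 31, [0, 5, 3,
     4, 1, 2]), (45, 16, [1, 4, 2, 5, 0, 3]), (47, 17, [0, 4, 2, 5, 1, 3]), (55, 9, [0, 3, 2, 5,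
     1, 4]), (59, 5, [0, 2, 3, 4, 1, 5])]), (84, [(32, 31, [5, 3, 4, 0, 1, 2]), (47, 16, [4, 2, 5,
     0, 1, 3])])]),
    ([], [0, 15, 23, 27, 29, 30, 31, 39, 43, 45, 46, 47, 53, 54, 57, 58, 59, 60, 61, 62, 63],
     [(81, [(39, 31, [0, 1, 2, 5, 3, 4]), (43, 31, [0, 1, 3, 5, 2, 4]), (45, 31, [0, 2, 3, 5, 1,
     4]), (46, 31, [1, 2, 3, 5, 0, 4]), (47, 23, [0, 1, 2, 4, 3, 5]), (47, 27, [0, 1, 3, 4, 2,
     5]), (47, 29, [0, 2, 3, 4, 1, 5]), (47, 30, [1, 2, 3, 4, 0, 5]), (53, 31, [0, 2, 4, 5, 1,
     3]), (53, 47, [0, 2, 5, 4, 1, 3]), (54, 31, [1, 2, 4, 5, 0, 3]), (54, 47, [1, 2, 5, 4, 0,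
     3]), (57, 31, [0, 3, 4, 5, 1, 2]), (57, 47, [0, 3, 5, 4, 1, 2]), (58, 31, [1, 3, 4, 5, 0,
     2]), (58, 47, [1, 3, 5, 4, 0, 2]), (59, 15, [0, 1, 3, 2, 4, 5]), (59, 23, [0, 1, 4, 2, 3,
     5]), (59, 29, [0, 3, 4, 2, 1, 5]), (59, 30, [1, 3, 4, 2, 0, 5]), (59, 39, [0, 1, 5, 2, 3,
     4]), (59, 45, [0, 3, 5, 2, 1, 4]), (59, 46, [1, 3, 5, 2, 0, 4]), (59, 53, [0, 4, 5, 2, 1,
     3]), (59, 54, [1, 4, 5, 2, 0, 3]), (60, 31, [2, 3, 4, 5, 0, 1]), (60, 47, [2, 3, 5, 4, 0,
     1]), (60, 59, [3, 4, 5, 2, 0, 1]), (61, 15, [0, 2, 3, 1, 4, 5]), (61, 23, [0, 2, 4, 1, 3,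
     5]), (61, 27, [0, 3, 4, 1, 2, 5]), (61, 30, [2, 3, 4, 1, 0, 5]), (61, 39, [0, 2, 5, 1, 3,
     4]), (61, 43, [0, 3, 5, 1, 2, 4]), (61, 46, [2, 3, 5, 1, 0, 4]), (61, 54, [2, 4, 5, 1, 0,
     3]), (61, 58, [3, 4, 5, 1, 0, 2]), (62, 15, [1, 2, 3, 0, 4, 5]), (62, 23, [1, 2, 4, 0, 3,
     5]), (62, 27, [1, 3, 4, 0, 2, 5]), (62, 29, [2, 3, 4, 0, 1, 5]), (62, 39, [1, 2, 5, 0, 3,
     4]), (62, 43, [1, 3, 5, 0, 2, 4]), (62, 45, [2, 3, 5, 0, 1, 4]), (62, 53, [2, 4, 5, 0, 1,
     3]), (62, 57, [3, 4, 5, 0, 1, 2])]), (85, [(39, 27, [0, 1, 2, 3, 4, 5]), (39, 29, [0, 2, 1,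
     3, 4, 5]), (39, 30, [1, 2, 0, 3, 4, 5]), (43, 23, [0, 1, 2, 3, 5, 4]), (43, 29, [0, 3, 1, 2,
     4, 5]), (43, 30, [1, 3, 0, 2, 4, 5]), (45, 23, [0, 2, 1, 3, 5, 4]), (45, 27, [0, 3, 1, 2, 5,
     4]), (45, 30, [2, 3, 0, 1, 4, 5]), (46, 23, [1, 2, 0, 3, 5, 4]), (46, 27, [1, 3, 0, 2, 5,
     4]), (46, 29, [2, 3, 0, 1, 5, 4]), (53, 15, [0, 2, 1, 4, 5, 3]), (53, 27, [0, 4, 1, 2, 5,
     3]), (53, 30, [2, 4, 0, 1, 3, 5]), (53, 43, [0, 5, 1, 2, 4, 3]), (53, 46, [2, 5, 0, 1, 3,
     4]), (54, 15, [1, 2, 0, 4, 5, 3]), (54, 27, [1, 4, 0, 2, 5, 3]), (54, 29, [2, 4, 0, 1, 5,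
     3]), (54, 43, [1, 5, 0, 2, 4, 3]), (54, 45, [2, 5, 0, 1, 4, 3]), (57, 15, [0, 3, 1, 4, 5,
     2]), (57, 23, [0, 4, 1, 3, 5, 2]), (57, 30, [3, 4, 0, 1, 2, 5]), (57, 39, [0, 5, 1, 3, 4,
     2]), (57, 46, [3, 5, 0, 1, 2, 4]), (57, 54, [4, 5, 0, 1, 2, 3]), (58, 15, [1, 3, 0, 4, 5,
     2]), (58, 23, [1, 4, 0, 3, 5, 2]), (58, 29, [3, 4, 0, 1, 5, 2]), (58, 39, [1, 5, 0, 3, 4,
     2]), (58, 45, [3, 5, 0, 1, 4, 2]), (58, 53, [4, 5, 0, 1, 3, 2]), (60, 15, [2, 3, 0, 4, 5,
     1]), (60, 23, [2, 4, 0, 3, 5, 1]), (60, 27, [3, 4, 0, 2, 5, 1]), (60, 39, [2, 5, 0, 3, 4,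
     1]), (60, 43, [3, 5, 0, 2, 4, 1])])])]"

text \<open>Evaluation is by \<open>code_simp\<close>, that is by rewriting through the kernel, so
  no generated code has to be trusted.\<close>

lemma derives_steps1: "derives (families) steps1"
  by code_simp

lemma derives_steps2: "derives (families @ map fst steps1) steps2"
  by code_simp

lemma derives_steps3: "derives ((families @ map fst steps1) @ map fst steps2) steps3"
  by code_simp

lemma derives_steps4: "derives (((families @ map fst steps1) @ map fst steps2) @ map fst steps3) steps4"
  by code_simp

text \<open>The empty list of relations holds for every enumeration of \<open>S\<close>, so this is
  the forward direction of the theorem.\<close>

lemma forces_trivial: "forces listed []"
proof -
  have "[] \<in> set (map fst steps4)"
    by (simp add: steps4_def)
  then show ?thesis
    using forces_derives [OF derives_steps4 forces_derives [OF derives_steps3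
      forces_derives [OF derives_steps2 forces_derives [OF derives_steps1 forces_families]]]]
    unfolding set_append by blast
qed

theorem theorem1p3:
  fixes S :: "'a::ab_group_add set"
  assumes "finite S" and "zero_sum_free S" and "card S = 6"
  shows "card (subset_sums S) = 19 \<longleftrightarrow>
    (\<exists>x1 x2 x3.
      (S = {x1, x2, x3, x1 + x3, x2 + x3, x1 + x2 + x3}
        \<and> add_ord x1 = 2 \<and> 2 \<cdot> x2 \<in> group_closure {x1})
    \<or> (S = {x1, x2, 2 \<cdot> x2, 3 \<cdot> x2, x1 + x2, x1 + 2 \<cdot> x2}
        \<and> add_ord x1 = 2)
    \<or> (S = {- (2 \<cdot> x1), x1, 3 \<cdot> x1, 4 \<cdot> x1, 5 \<cdot> x1, 6 \<cdot> x1}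
        \<and> add_ord x1 = 20)
    \<or> (S = {- (3 \<cdot> x1), x1, 4 \<cdot> x1, 5 \<cdot> x1, 9 \<cdot> x1, 12 \<cdot> x1}
        \<and> add_ord x1 = 20)
    \<or> (S = {x1, x2, x1 + x2, x1 + 2 \<cdot> x2, 2 \<cdot> x1 + x2, 4 \<cdot> x1 + 4 \<cdot> x2}
        \<and> 2 \<cdot> x1 = 2 \<cdot> x2 \<and> add_ord x1 = 10 \<and> add_ord x2 = 10))"
proof -
  obtain xs where xs: "set xs = S" "distinct xs"
    using finite_distinct_list [OF assms(1)] by blast
  then have "length xs = 6"
    using assms(3) distinct_card by metis
  then have "listed S" if "card (subset_sums S) = 19"
    using forces_trivial xs assms(2) that unfolding forces_def by (metis empty_iff list.set(1))
  then have "card (subset_sums S) = 19 \<longleftrightarrow> listed S"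
    using card_subset_sums_listed assms by blast
  then show ?thesis
    unfolding listed_def .
qed

end
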